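(* Let $T^2_s$ be the theory of the random $K_s$-free graph in the language $\{E(x,y)\}$, and let $\mathcal{U}$ be a monster model of $T^2_s$. Let $p_*$ be the unique global complete type (in one variable $x$) extending $\{\neg E(x,b):b\in\mathcal{U}\}$. Then $\delta_{p_*}$ is sequentially approximated (even finitely approximated over any submodel $M\prec\mathcal{U}$), but $p_*$ is not sequentially approximated. Moreover, $T^2_s$ admits no (non-realized) sequentially approximated types: for every finite tuple of variables $x$, no type in $S_x(\mathcal{U})$ which is not realized in $\mathcal{U}$ is sequentially approximated.
   Context: $K_s$ is the complete graph on $s$ vertices. The random $K_s$-free graph (Henson graph) is the Fraïssé limit of the class of finite graphs containing no copy of $K_s$. $\mathcal{U}$ is a monster model (sufficiently saturated and strongly homogeneous), "small" means of cardinality smaller than the degree of saturation, and submodels $M\prec\mathcal{U}$ are small elementary submodels. $S_x(\mathcal{U})$ is the space of complete types in $x$ over $\mathcal{U}$ ("global" types), with the Stone topology. For $p\in S_x(\mathcal{U})$, $\delta_p$ is the corresponding Keisler measure (finitely additive probability measure on the Boolean algebra $\mathcal{L}_x(\mathcal{U})$ of formulas in $x$ over $\mathcal{U}$): $\delta_p(\varphi(x))=1$ if $\varphi(x)\in p$ and $0$ otherwise. For $\overline{a}=(a_1,\dots,a_n)$ a finite sequence in $\mathcal{U}^x$, $\operatorname{Av}(\overline{a})(\psi(x))=\frac1n|\{1\le i\le n:\mathcal{U}\models\psi(a_i)\}|$. $(M^x)^{<\omega}$ is the set of finite sequences of points of $M^x$. A type $p\in S_x(\mathcal{U})$ is sequentially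 approximated if there are a small $M\prec\mathcal{U}$ and a sequence $(a_i)_{i\in\omega}$ in $M^x$ with $\lim_{i\to\infty}\operatorname{tp}(a_i/\mathcal{U})=p$ in $S_x(\mathcal{U})$. A Keisler measure $\mu$ in $x$ over $\mathcal{U}$ is sequentially approximated if there are a small $M\prec\mathcal{U}$ and a sequence $(\overline{a}_i)_{i\in\omega}$ in $(M^x)^{<\omega}$ with $\lim_{i\to\infty}\operatorname{Av}(\overline{a}_i)(\varphi(x))=\mu(\varphi(x))$ for every $\varphi(x)\in\mathcal{L}_x(\mathcal{U})$. $\mu$ is finitely approximated over $M$ if for every formula $\varphi(x,y)$ without parameters and every $\epsilon>0$ there is $\overline{a}\in(M^x)^{<\omega}$ with $\sup_{b\in\mathcal{U}^y}|\mu(\varphi(x,b))-\operatorname{Av}(\overline{a})(\varphi(x,b))|<\epsilon$. *)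

theory Defs
  imports "HOL-Analysis.Analysis"
begin

section \<open>First-order logic in the language of graphs\<close>

(* A structure in the language with one binary relation symbol.  Only the restriction of
   edge_rel to univ is relevant. *)
record 'a struc =
  univ :: "'a set"
  edge_rel :: "'a \<Rightarrow> 'a \<Rightarrow> bool"

(* Formulas without parameters; variables are indexed by natural numbers. *)
datatype fm =
    FEq nat nat
  | FEdge nat nat
  | FNeg fm
  | FConj fm fm
  | FEx nat fm

primrec fv :: "fm \<Rightarrow> nat set" where
  "fv (FEq i j) = {i, j}"
| "fv (FEdge i j) = {i, j}"
| "fv (FNeg \<phi>) = fv \<phi>"
| "fv (FConj \<phi> \<psi>) = fv \<phi> \<union> fv \<psi>"
| "fv (FEx k \<phi>) = fv \<phi> - {k}"

primrec sat :: "'a struc \<Rightarrow> (nat \<Rightarrow> 'a) \<Rightarrow> fm \<Rightarrow> bool" where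
  "sat G v (FEq i j) \<longleftrightarrow> v i = v j"
| "sat G v (FEdge i j) \<longleftrightarrow> edge_rel G (v i) (v j)"
| "sat G v (FNeg \<phi>) \<longleftrightarrow> \<not> sat G v \<phi>"
| "sat G v (FConj \<phi> \<psi>) \<longleftrightarrow> sat G v \<phi> \<and> sat G v \<psi>"
| "sat G v (FEx k \<phi>) \<longleftrightarrow> (\<exists>a\<in>univ G. sat G (v(k := a)) \<phi>)"

definition tuples :: "nat \<Rightarrow> 'a set \<Rightarrow> 'a list set" where
  "tuples n A = {a. length a = n \<and> set a \<subseteq> A}"

(* A formula phi(x,b) with parameters is a parameter-free formula phi(x,y) together with the
   tuple b substituted for y.  If x has length n, then the variables of x are 0, ..., n-1 and
   those of y are n, ..., n + length b - 1. *)
type_synonym 'a pfm = "fm \<times> 'a list"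

definition pformulas :: "nat \<Rightarrow> 'a set \<Rightarrow> 'a pfm set" where
  "pformulas n A = {(\<phi>, b). fv \<phi> \<subseteq> {..<n + length b} \<and> set b \<subseteq> A}"

fun pneg :: "'a pfm \<Rightarrow> 'a pfm" where
  "pneg (\<phi>, b) = (FNeg \<phi>, b)"

fun holds :: "'a struc \<Rightarrow> 'a pfm \<Rightarrow> 'a list \<Rightarrow> bool" where
  "holds G (\<phi>, b) a \<longleftrightarrow> sat G (\<lambda>i. (a @ b) ! i) \<phi>"

definition theory_of :: "'a struc \<Rightarrow> fm set" where
  "theory_of G = {\<sigma>. fv \<sigma> = {} \<and> holds G (\<sigma>, []) []}"

definition models :: "'a struc \<Rightarrow> fm set \<Rightarrow> bool" where
  "models G T \<longleftrightarrow> univ G \<noteq> {} \<and> (\<forall>\<sigma>\<in>T. holds G (\<sigma>, []) [])"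

definition elementary_submodel :: "'a set \<Rightarrow> 'a struc \<Rightarrow> bool" where
  "elementary_submodel M G \<longleftrightarrow> M \<noteq> {} \<and> M \<subseteq> univ G \<and>
     (\<forall>n. \<forall>\<phi>\<in>pformulas n {}. \<forall>a\<in>tuples n M.
        holds (G\<lparr>univ := M\<rparr>) \<phi> a \<longleftrightarrow> holds G \<phi> a)"


section \<open>The random \<open>K\<^sub>s\<close>-free graph\<close>

definition embedding :: "('a \<Rightarrow> 'b) \<Rightarrow> 'a struc \<Rightarrow> 'b struc \<Rightarrow> bool" where
  "embedding f G H \<longleftrightarrow> inj_on f (univ G) \<and> f ` univ G \<subseteq> univ H \<and>
     (\<forall>a\<in>univ G. \<forall>b\<in>univ G. edge_rel G a b \<longleftrightarrow> edge_rel H (f a) (f b))"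

definition automorphism :: "('a \<Rightarrow> 'a) \<Rightarrow> 'a struc \<Rightarrow> bool" where
  "automorphism g G \<longleftrightarrow> embedding g G G \<and> g ` univ G = univ G"

definition is_graph :: "'a struc \<Rightarrow> bool" where
  "is_graph G \<longleftrightarrow>
     (\<forall>a\<in>univ G. \<not> edge_rel G a a) \<and>
     (\<forall>a\<in>univ G. \<forall>b\<in>univ G. edge_rel G a b \<longrightarrow> edge_rel G b a)"

definition complete_graph :: "nat \<Rightarrow> nat struc" where
  "complete_graph s = \<lparr>univ = {..<s}, edge_rel = (\<lambda>i j. i \<noteq> j)\<rparr>"

definition finite_clique_free :: "nat \<Rightarrow> nat struc \<Rightarrow> bool" where
  "finite_clique_free s G \<longleftrightarrow> finite (univ G) \<and> is_graph G \<and>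
     (\<nexists>f. embedding f (complete_graph s) G)"

definition ultrahomogeneous :: "'a struc \<Rightarrow> bool" where
  "ultrahomogeneous G \<longleftrightarrow>
     (\<forall>A f. finite A \<longrightarrow> A \<subseteq> univ G \<longrightarrow> embedding f (G\<lparr>univ := A\<rparr>) G \<longrightarrow>
        (\<exists>g. automorphism g G \<and> (\<forall>a\<in>A. g a = f a)))"

(* The class K is represented by its members whose vertices are natural numbers; up to
   isomorphism these are all the finite structures in it. *)
definition fraisse_limit :: "(nat struc \<Rightarrow> bool) \<Rightarrow> 'a struc \<Rightarrow> bool" where
  "fraisse_limit K G \<longleftrightarrow> countable (univ G) \<and> ultrahomogeneous G \<and>
     (\<forall>A. K A \<longleftrightarrow> finite (univ A) \<and> (\<exists>f. embedding f A G))"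

definition random_clique_free_graph :: "nat \<Rightarrow> 'a struc \<Rightarrow> bool" where
  "random_clique_free_graph s G \<longleftrightarrow> fraisse_limit (finite_clique_free s) G"


section \<open>Types and monster models\<close>

definition finitely_satisfiable :: "'a struc \<Rightarrow> nat \<Rightarrow> 'a pfm set \<Rightarrow> bool" where
  "finitely_satisfiable G n q \<longleftrightarrow>
     (\<forall>F. finite F \<longrightarrow> F \<subseteq> q \<longrightarrow> (\<exists>a\<in>tuples n (univ G). \<forall>\<phi>\<in>F. holds G \<phi> a))"

definition realized :: "'a struc \<Rightarrow> nat \<Rightarrow> 'a pfm set \<Rightarrow> bool" where
  "realized G n q \<longleftrightarrow> (\<exists>a\<in>tuples n (univ G). \<forall>\<phi>\<in>q. holds G \<phi> a)"

definition types :: "'a struc \<Rightarrow> nat \<Rightarrow> 'a set \<Rightarrow> 'a pfm set set" where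
  "types G n A = {p. p \<subseteq> pformulas n A \<and> finitely_satisfiable G n p \<and>
                     (\<forall>\<phi>\<in>pformulas n A. \<phi> \<in> p \<or> pneg \<phi> \<in> p)}"

abbreviation global_types :: "'a struc \<Rightarrow> nat \<Rightarrow> 'a pfm set set" where
  "global_types U n \<equiv> types U n (univ U)"

definition global_tp :: "'a struc \<Rightarrow> 'a list \<Rightarrow> 'a pfm set" where
  "global_tp U a = {\<phi> \<in> pformulas (length a) (univ U). holds U \<phi> a}"

definition stone_topology :: "'a struc \<Rightarrow> nat \<Rightarrow> 'a pfm set topology" where
  "stone_topology U n =
     topology_generated_by ((\<lambda>\<phi>. {p \<in> global_types U n. \<phi> \<in> p}) ` pformulas n (univ U))"

(* Cardinals are represented as in the library, by initial well-orders. *)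
definition small :: "'k rel \<Rightarrow> 'a set \<Rightarrow> bool" where
  "small \<kappa> A \<longleftrightarrow> (card_of A, \<kappa>) \<in> ordLess"

definition saturated :: "'k rel \<Rightarrow> 'a struc \<Rightarrow> bool" where
  "saturated \<kappa> U \<longleftrightarrow>
     (\<forall>A. A \<subseteq> univ U \<longrightarrow> small \<kappa> A \<longrightarrow> (\<forall>n. \<forall>p\<in>types U n A. realized U n p))"

definition partial_elementary :: "('a \<Rightarrow> 'a) \<Rightarrow> 'a set \<Rightarrow> 'a struc \<Rightarrow> bool" where
  "partial_elementary f A U \<longleftrightarrow> f ` A \<subseteq> univ U \<and>
     (\<forall>n. \<forall>\<phi>\<in>pformulas n {}. \<forall>a\<in>tuples n A. holds U \<phi> a \<longleftrightarrow> holds U \<phi> (map f a))"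

definition strongly_homogeneous :: "'k rel \<Rightarrow> 'a struc \<Rightarrow> bool" where
  "strongly_homogeneous \<kappa> U \<longleftrightarrow>
     (\<forall>A f. A \<subseteq> univ U \<longrightarrow> small \<kappa> A \<longrightarrow> partial_elementary f A U \<longrightarrow>
        (\<exists>g. automorphism g U \<and> (\<forall>a\<in>A. g a = f a)))"

(* The degree of saturation kappa is any uncountable cardinal. *)
definition monster_model :: "'k rel \<Rightarrow> fm set \<Rightarrow> 'a struc \<Rightarrow> bool" where
  "monster_model \<kappa> T U \<longleftrightarrow> Card_order \<kappa> \<and> (natLeq, \<kappa>) \<in> ordLess \<and>
     models U T \<and> saturated \<kappa> U \<and> strongly_homogeneous \<kappa> U"

definition small_submodel :: "'k rel \<Rightarrow> 'a struc \<Rightarrow> 'a set \<Rightarrow> bool" where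
  "small_submodel \<kappa> U M \<longleftrightarrow> elementary_submodel M U \<and> small \<kappa> M"


section \<open>Keisler measures and approximation\<close>

definition solutions :: "'a struc \<Rightarrow> nat \<Rightarrow> 'a pfm \<Rightarrow> 'a list set" where
  "solutions U n \<phi> = {a \<in> tuples n (univ U). holds U \<phi> a}"

(* The Boolean operations of the algebra of formulas modulo equivalence are those of the
   solution sets, so in the last clause theta is (equivalent to) the disjunction of phi and psi. *)
definition keisler_measure :: "'a struc \<Rightarrow> nat \<Rightarrow> ('a pfm \<Rightarrow> real) \<Rightarrow> bool" where
  "keisler_measure U n \<mu> \<longleftrightarrow>
     (\<forall>\<phi>\<in>pformulas n (univ U). 0 \<le> \<mu> \<phi>) \<and>
     (\<forall>\<phi>\<in>pformulas n (univ U). solutions U n \<phi> = tuples n (univ U) \<longrightarrow> \<mu> \<phi> = 1) \<and>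
     (\<forall>\<phi>\<in>pformulas n (univ U). \<forall>\<psi>\<in>pformulas n (univ U). \<forall>\<theta>\<in>pformulas n (univ U).
        solutions U n \<phi> \<inter> solutions U n \<psi> = {} \<longrightarrow>
        solutions U n \<theta> = solutions U n \<phi> \<union> solutions U n \<psi> \<longrightarrow>
        \<mu> \<theta> = \<mu> \<phi> + \<mu> \<psi>)"

definition delta :: "'a pfm set \<Rightarrow> 'a pfm \<Rightarrow> real" where
  "delta p \<phi> = (if \<phi> \<in> p then 1 else 0)"

definition Av :: "'a struc \<Rightarrow> 'a list list \<Rightarrow> 'a pfm \<Rightarrow> real" where
  "Av U as \<phi> = real (card {i. i < length as \<and> holds U \<phi> (as ! i)}) / real (length as)"

(* The empty sequence is excluded, since its average is undefined. *)
definition finite_seqs :: "nat \<Rightarrow> 'a set \<Rightarrow> 'a list list set" where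
  "finite_seqs n M = {as. as \<noteq> [] \<and> set as \<subseteq> tuples n M}"

definition seq_approx_type :: "'k rel \<Rightarrow> 'a struc \<Rightarrow> nat \<Rightarrow> 'a pfm set \<Rightarrow> bool" where
  "seq_approx_type \<kappa> U n p \<longleftrightarrow>
     (\<exists>M a. small_submodel \<kappa> U M \<and> (\<forall>i::nat. a i \<in> tuples n M) \<and>
        limitin (stone_topology U n) (\<lambda>i. global_tp U (a i)) p sequentially)"

definition seq_approx_measure :: "'k rel \<Rightarrow> 'a struc \<Rightarrow> nat \<Rightarrow> ('a pfm \<Rightarrow> real) \<Rightarrow> bool" where
  "seq_approx_measure \<kappa> U n \<mu> \<longleftrightarrow> keisler_measure U n \<mu> \<and>
     (\<exists>M as. small_submodel \<kappa> U M \<and> (\<forall>i::nat. as i \<in> finite_seqs n M) \<and>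
        (\<forall>\<phi>\<in>pformulas n (univ U). (\<lambda>i. Av U (as i) \<phi>) \<longlonglongrightarrow> \<mu> \<phi>))"

definition fin_approx_measure :: "'a struc \<Rightarrow> 'a set \<Rightarrow> nat \<Rightarrow> ('a pfm \<Rightarrow> real) \<Rightarrow> bool" where
  "fin_approx_measure U M n \<mu> \<longleftrightarrow> keisler_measure U n \<mu> \<and>
     (\<forall>m \<phi> \<epsilon>. fv \<phi> \<subseteq> {..<n + m} \<longrightarrow> 0 < \<epsilon> \<longrightarrow>
        (\<exists>as\<in>finite_seqs n M.
           (SUP b\<in>tuples m (univ U). \<bar>\<mu> (\<phi>, b) - Av U as (\<phi>, b)\<bar>) < \<epsilon>))"


section \<open>The type of an isolated vertex\<close>

definition nonadjacency :: "'a struc \<Rightarrow> 'a pfm set" where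
  "nonadjacency U = {(FNeg (FEdge 0 1), [b]) | b. b \<in> univ U}"

definition p_star :: "'a struc \<Rightarrow> 'a pfm set" where
  "p_star U = (THE p. p \<in> global_types U 1 \<and> nonadjacency U \<subseteq> p)"

end

theory Submission
  imports Defs "HOL-Library.Ramsey" "HOL-Library.Countable_Set_Type"
begin

text \<open>Write \<open>s = r + 1\<close>. Everything rests on one first-order property of a graph \<open>G\<close>, called
  \<open>henson r G\<close> below: \<open>G\<close> has no clique of size \<open>r + 1\<close>, and for finite disjoint sets \<open>A\<close>, \<open>B\<close> of
  vertices such that \<open>A\<close> has no clique of size \<open>r\<close> there is a new vertex joined to all of \<open>A\<close> and to
  nothing in \<open>B\<close>. The Fraisse limit has this property by ultrahomogeneity
  (\<open>henson_fraisse_limit\<close>); sentences express it, so it passes to \<open>U\<close> and to every elementary submodel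
  (\<open>henson_elementary\<close>); and by back-and-forth the quantifier-free type of a tuple in such a
  graph decides all formulas (\<open>sat_qf_equiv\<close>). In particular a formula \<open>\<phi>(x, b)\<close> has the same truth
  value at all vertices that avoid \<open>b\<close> and have no neighbour in \<open>b\<close>, and these values form the
  type \<open>p\<^sub>*\<close>.

  The measure of \<open>p\<^sub>*\<close> is a limit of averages for a combinatorial reason. If \<open>b\<close> is a vertex of \<open>U\<close>,
  then its neighbours in any finite set of vertices contain no clique of size \<open>r\<close>, since \<open>b\<close> would
  extend it. Erdos and Rogers found finite graphs without cliques of size \<open>r + 1\<close> in which every
  set without a clique of size \<open>r\<close> is an arbitrarily small fraction of the vertices
  (\<open>erdos_rogers\<close>). A copy of such a graph inside \<open>M\<close> is a sequence of vertices of which no \<open>b\<close> sees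
  more than that fraction, and the bound is uniform in \<open>b\<close>
  (\<open>exists_sparse_sequence\<close>, \<open>average_close_to_delta\<close>). This is finite approximation over
  \<open>M\<close>; inside one countable submodel, copies for fractions tending to \<open>0\<close> approximate sequentially.

  No sequence of types of points has an unrealized limit \<open>p\<close>, because edges do not converge. If
  \<open>p\<close> is not realized, then in some coordinate the sequence leaves every vertex of \<open>U\<close>, hence takes
  infinitely many values. By Ramsey's theorem infinitely many of these values are pairwise
  nonadjacent, and saturation gives a vertex \<open>b\<close> of \<open>U\<close> joined to infinitely many of them and not
  joined to infinitely many others. So the truth value of \<open>E(x, b)\<close> along the sequence has no limit
  (\<open>exists_vertex_splitting_sequence\<close>, \<open>no_seq_approx_type\<close>).\<close>

section \<open>Cliques\<close>

definition is_clique :: "'a struc \<Rightarrow> 'a set \<Rightarrow> bool" where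
  "is_clique G Q \<longleftrightarrow> (\<forall>u\<in>Q. \<forall>v\<in>Q. u \<noteq> v \<longrightarrow> edge_rel G u v)"

definition clique_free :: "nat \<Rightarrow> 'a struc \<Rightarrow> 'a set \<Rightarrow> bool" where
  "clique_free r G X \<longleftrightarrow> (\<forall>Q. Q \<subseteq> X \<longrightarrow> finite Q \<longrightarrow> card Q = r \<longrightarrow> \<not> is_clique G Q)"

section \<open>Hypergraphs with few short cycles\<close>

text \<open>The Erdos-Rogers graphs come from a random \<open>k\<close>-uniform hypergraph on \<open>N\<close> vertices with a linear
  number \<open>c * N\<close> of hyperedges. Such a hypergraph has a bounded expected number of short cycles, while a large
  constant \<open>c\<close> makes every set of proportional size contain a hyperedge. A hyperedge is a \<open>k\<close>-tuple in which
  repetitions are possible, so that the sample space is a plain function space and probabilities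
  are ratios of cardinalities.\<close>

definition tuple_systems :: "nat \<Rightarrow> nat \<Rightarrow> nat \<Rightarrow> (nat \<Rightarrow> nat \<Rightarrow> nat) set" where
  "tuple_systems m k N = ({..<m} \<rightarrow>\<^sub>E ({..<k} \<rightarrow>\<^sub>E {..<N}))"

text \<open>A pattern for a Berge cycle of length \<open>g\<close>: distinct hyperedges in cyclic order, each as a triple
  \<open>(i, a, b)\<close> of its index and two different positions, where the cycle enters it and where it leaves it. A
  pattern of length 1 that closes up is a hyperedge with a repeated vertex.\<close>

definition cycle_patterns :: "nat \<Rightarrow> nat \<Rightarrow> nat \<Rightarrow> (nat \<times> nat \<times> nat) list set" where
  "cycle_patterns m k g = {xs. length xs = g \<and> set xs \<subseteq> {..<m} \<times> {..<k} \<times> {..<k} \<and>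
     distinct (map fst xs) \<and> (\<forall>x\<in>set xs. fst (snd x) \<noteq> snd (snd x))}"

definition entry :: "(nat \<Rightarrow> nat \<Rightarrow> nat) \<Rightarrow> nat \<times> nat \<times> nat \<Rightarrow> nat" where
  "entry F x = F (fst x) (fst (snd x))"

definition exit :: "(nat \<Rightarrow> nat \<Rightarrow> nat) \<Rightarrow> nat \<times> nat \<times> nat \<Rightarrow> nat" where
  "exit F x = F (fst x) (snd (snd x))"

definition closes :: "(nat \<Rightarrow> nat \<Rightarrow> nat) \<Rightarrow> (nat \<times> nat \<times> nat) list \<Rightarrow> bool" where
  "closes F xs \<longleftrightarrow> (\<forall>t<length xs. exit F (xs ! t) = entry F (xs ! (Suc t mod length xs)))"

lemma finite_tuple_systems: "finite (tuple_systems m k N)"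
  by (simp add: tuple_systems_def finite_PiE)

lemma card_tuple_systems: "card (tuple_systems m k N) = (N ^ k) ^ m"
  by (simp add: tuple_systems_def card_PiE finite_PiE)

lemma cycle_patterns_subset:
  "cycle_patterns m k g \<subseteq> {xs. set xs \<subseteq> {..<m} \<times> {..<k} \<times> {..<k} \<and> length xs = g}"
  by (auto simp: cycle_patterns_def)

lemma finite_cycle_patterns: "finite (cycle_patterns m k g)"
  by (rule finite_subset[OF cycle_patterns_subset]) (simp add: finite_lists_length_eq)

lemma card_cycle_patterns: "card (cycle_patterns m k g) \<le> (m * k\<^sup>2) ^ g"
proof -
  have "card (cycle_patterns m k g)
      \<le> card {xs. set xs \<subseteq> {..<m} \<times> {..<k} \<times> {..<k} \<and> length xs = g}"
    by (rule card_mono[OF _ cycle_patterns_subset]) (simp add: finite_lists_length_eq)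
  also have "\<dots> = (m * k\<^sup>2) ^ g"
    by (simp add: card_lists_length_eq card_cartesian_product power2_eq_square)
  finally show ?thesis .
qed

text \<open>The \<open>g\<close> exit positions of a pattern are different from each other and from all entry positions. A
  system in which the pattern closes up has at each exit the same value as at the next entry, so it is
  determined by its values off the exits. Hence the pattern closes up with probability at most
  \<open>N\<close> to the power \<open>-g\<close>.\<close>

lemma card_closing_systems:
  assumes "xs \<in> cycle_patterns m k g"
  shows "card {F \<in> tuple_systems m k N. closes F xs} * N ^ g \<le> card (tuple_systems m k N)"
proof -
  define P where "P = {..<m} \<times> {..<k}"
  define out where "out t = (fst (xs ! t), snd (snd (xs ! t)))" for t
  define inn where "inn t = (fst (xs ! t), fst (snd (xs ! t)))" for t
  define D where "D = out ` {..<g}"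
  define R where "R F = (\<lambda>p\<in>P - D. F (fst p) (snd p) :: nat)" for F :: "nat \<Rightarrow> nat \<Rightarrow> nat"
  have len: "length xs = g" and dist: "distinct (map fst xs)"
    and sub: "set xs \<subseteq> {..<m} \<times> {..<k} \<times> {..<k}"
    and neq: "\<And>x. x \<in> set xs \<Longrightarrow> fst (snd x) \<noteq> snd (snd x)"
    using assms by (auto simp: cycle_patterns_def)
  have same_index: "t = t'" if "fst (xs ! t) = fst (xs ! t')" "t < g" "t' < g" for t t'
    using dist len that by (metis length_map nth_eq_iff_index_eq nth_map)
  have mem: "xs ! t \<in> {..<m} \<times> {..<k} \<times> {..<k}" if "t < g" for t
    using sub len that nth_mem by blast
  have outP: "out t \<in> P" and innP: "inn t \<in> P" if "t < g" for t
    using mem[OF that] by (auto simp: out_def inn_def P_def mem_Times_iff)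
  have innD: "inn t \<notin> D" if "t < g" for t
  proof
    assume "inn t \<in> D"
    then obtain t' where t': "t' < g" "inn t = out t'"
      by (auto simp: D_def)
    then have "t = t'"
      using same_index that by (auto simp: inn_def out_def)
    then show False
      using neq[of "xs ! t"] t' len that by (auto simp: inn_def out_def)
  qed
  have finP: "finite P" and DP: "D \<subseteq> P"
    using outP unfolding D_def by (simp add: P_def, blast)
  have "inj_on out {..<g}"
    by (auto simp: inj_on_def out_def intro: same_index)
  then have cardD: "card D = g"
    by (simp add: D_def card_image)
  have inj: "inj_on R {F \<in> tuple_systems m k N. closes F xs}"
  proof (rule inj_onI, clarify)
    fix F F'
    assume F: "F \<in> tuple_systems m k N" "closes F xs"
      and F': "F' \<in> tuple_systems m k N" "closes F' xs" and R: "R F = R F'"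
    have off: "F (fst p) (snd p) = F' (fst p) (snd p)" if "p \<in> P - D" for p
      using fun_cong[OF R, of p] that by (simp add: R_def)
    have on: "F (fst p) (snd p) = F' (fst p) (snd p)" if "p \<in> D" for p
    proof -
      from that obtain t where t: "t < g" "p = out t"
        unfolding D_def by blast
      define t' where "t' = Suc t mod g"
      have "t' < g"
        using t by (simp add: t'_def)
      then have "F (fst (inn t')) (snd (inn t')) = F' (fst (inn t')) (snd (inn t'))"
        using off innP innD by blast
      then show ?thesis
        using F(2) F'(2) t len
        by (auto simp: closes_def entry_def exit_def inn_def out_def t'_def)
    qed
    have agree: "F i a = F' i a" if "i < m" "a < k" for i a
      using on[of "(i, a)"] off[of "(i, a)"] that by (cases "(i, a) \<in> D") (auto simp: P_def)
    show "F = F'"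
    proof (rule PiE_ext)
      show "F \<in> ({..<m} \<rightarrow>\<^sub>E ({..<k} \<rightarrow>\<^sub>E {..<N}))" "F' \<in> ({..<m} \<rightarrow>\<^sub>E ({..<k} \<rightarrow>\<^sub>E {..<N}))"
        using F F' by (auto simp: tuple_systems_def)
    next
      fix i assume "i \<in> {..<m}"
      then have "F i \<in> ({..<k} \<rightarrow>\<^sub>E {..<N})" "F' i \<in> ({..<k} \<rightarrow>\<^sub>E {..<N})"
        using F F' by (auto simp: tuple_systems_def dest: PiE_mem)
      then show "F i = F' i"
        by (rule PiE_ext) (use agree \<open>i \<in> {..<m}\<close> in auto)
    qed
  qed
  have "R ` {F \<in> tuple_systems m k N. closes F xs} \<subseteq> ((P - D) \<rightarrow>\<^sub>E {..<N})"
    by (force simp: R_def tuple_systems_def P_def intro!: PiE_I dest: PiE_mem)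
  then have "card {F \<in> tuple_systems m k N. closes F xs} \<le> card ((P - D) \<rightarrow>\<^sub>E {..<N})"
    by (rule card_inj_on_le[OF inj]) (simp add: finite_PiE finP)
  also have "\<dots> = N ^ (m * k - g)"
    using finP DP cardD by (simp add: card_PiE card_Diff_subset finite_subset P_def)
  finally have "card {F \<in> tuple_systems m k N. closes F xs} * N ^ g \<le> N ^ (m * k - g) * N ^ g"
    by simp
  also have "\<dots> = N ^ (m * k)"
  proof -
    have "g \<le> m * k"
      using card_mono[OF finP DP] cardD by (simp add: P_def)
    then show ?thesis
      by (simp flip: power_add)
  qed
  also have "\<dots> = card (tuple_systems m k N)"
    by (simp add: card_tuple_systems power_mult mult.commute)
  finally show ?thesis .
qed

text \<open>With \<open>c * N\<close> hyperedges the number of patterns grows like the \<open>g\<close>-th power of \<open>N\<close>, which cancels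
  the probability of closing up: the expected number of cycles of length \<open>g\<close> does not depend on \<open>N\<close>.\<close>

lemma sum_closing_patterns:
  assumes "0 < N"
  shows "(\<Sum>F\<in>tuple_systems (c * N) k N. card {xs \<in> cycle_patterns (c * N) k g. closes F xs})
    \<le> (c * k\<^sup>2) ^ g * card (tuple_systems (c * N) k N)" (is "?S \<le> _ * card ?\<Omega>")
proof -
  let ?T = "cycle_patterns (c * N) k g"
  have "?S = (\<Sum>xs\<in>?T. card {F \<in> ?\<Omega>. closes F xs})"
    using sum_multicount_gen[of ?\<Omega> ?T "\<lambda>F xs. closes F xs" "\<lambda>xs. card {F \<in> ?\<Omega>. closes F xs}"]
    by (simp add: finite_tuple_systems finite_cycle_patterns)
  then have "?S * N ^ g = (\<Sum>xs\<in>?T. card {F \<in> ?\<Omega>. closes F xs} * N ^ g)"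
    by (simp add: sum_distrib_right)
  also have "\<dots> \<le> (\<Sum>xs\<in>?T. card ?\<Omega>)"
    by (intro sum_mono card_closing_systems)
  also have "\<dots> \<le> (c * N * k\<^sup>2) ^ g * card ?\<Omega>"
    using card_cycle_patterns by (simp add: mult_right_mono)
  also have "\<dots> = ((c * k\<^sup>2) ^ g * card ?\<Omega>) * N ^ g"
    by (simp add: power_mult_distrib)
  finally show ?thesis
    using assms by simp
qed

lemma card_systems_missing_set:
  assumes "S \<subseteq> {..<N}" "N \<le> r * card S" "0 < r"
  shows "real (card {F \<in> tuple_systems m k N. \<forall>i<m. \<not> F i ` {..<k} \<subseteq> S})
    \<le> real (card (tuple_systems m k N)) * (1 - (1 / real r) ^ k) ^ m"
proof -
  let ?W = "{..<k} \<rightarrow>\<^sub>E {..<N}" and ?WS = "{..<k} \<rightarrow>\<^sub>E S"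
  have finS: "finite S"
    using assms(1) finite_subset by blast
  have sub: "?WS \<subseteq> ?W"
    using assms(1) by (rule PiE_mono) 
  have "{F \<in> tuple_systems m k N. \<forall>i<m. \<not> F i ` {..<k} \<subseteq> S} \<subseteq> ({..<m} \<rightarrow>\<^sub>E (?W - ?WS))"
  proof clarify
    fix F assume F: "F \<in> tuple_systems m k N" and miss: "\<forall>i<m. \<not> F i ` {..<k} \<subseteq> S"
    show "F \<in> ({..<m} \<rightarrow>\<^sub>E (?W - ?WS))"
    proof (rule PiE_I)
      fix i assume "i \<in> {..<m}"
      then show "F i \<in> ?W - ?WS"
        using F miss by (auto simp: tuple_systems_def dest: PiE_mem)
    next
      fix i assume "i \<notin> {..<m}"
      then show "F i = undefined"
        using F by (auto simp: tuple_systems_def dest: PiE_arb)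
    qed
  qed
  then have "card {F \<in> tuple_systems m k N. \<forall>i<m. \<not> F i ` {..<k} \<subseteq> S}
      \<le> card ({..<m} \<rightarrow>\<^sub>E (?W - ?WS))"
    by (intro card_mono) (simp_all add: finite_PiE)
  also have "\<dots> = (N ^ k - card S ^ k) ^ m"
    using sub finS by (simp add: card_PiE card_Diff_subset finite_PiE)
  finally have "real (card {F \<in> tuple_systems m k N. \<forall>i<m. \<not> F i ` {..<k} \<subseteq> S})
      \<le> real ((N ^ k - card S ^ k) ^ m)"
    by (rule of_nat_mono)
  also have "\<dots> = (real N ^ k - real (card S) ^ k) ^ m"
    using card_mono[OF _ assms(1)] by (simp add: of_nat_diff power_mono)
  also have "\<dots> \<le> (real N ^ k - (real N / real r) ^ k) ^ m"
  proof (intro power_mono diff_mono order_refl)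
    have "real N \<le> real r * real (card S)"
      using assms(2) by (metis of_nat_le_iff of_nat_mult)
    then show "real N / real r \<le> real (card S)"
      using assms(3) by (simp add: field_simps)
    show "0 \<le> real N ^ k - real (card S) ^ k"
      using card_mono[OF _ assms(1)] by (simp add: power_mono)
  qed auto
  also have "\<dots> = (real N ^ k * (1 - (1 / real r) ^ k)) ^ m"
    by (simp add: power_divide algebra_simps)
  also have "\<dots> = real (card (tuple_systems m k N)) * (1 - (1 / real r) ^ k) ^ m"
    by (simp add: card_tuple_systems power_mult_distrib)
  finally show ?thesis .
qed

text \<open>Union bound: there are at most \<open>2\<close> to the power \<open>N\<close> sets, and each large one is missed by all
  hyperedges with probability at most \<open>1/4\<close> to the power \<open>N\<close>.\<close>

lemma card_systems_missing_large_set: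
  assumes c: "(1 - (1 / real r) ^ k) ^ c \<le> 1 / 4" and "0 < r" "2 \<le> N"
  shows "2 * card {F \<in> tuple_systems (c * N) k N. \<exists>S\<subseteq>{..<N}. N \<le> r * card S \<and>
    (\<forall>i<c * N. \<not> F i ` {..<k} \<subseteq> S)} < card (tuple_systems (c * N) k N)"
proof -
  let ?\<Omega> = "tuple_systems (c * N) k N" and ?\<theta> = "1 - (1 / real r) ^ k"
  define \<S> where "\<S> = {S. S \<subseteq> {..<N} \<and> N \<le> r * card S}"
  define X where "X S = {F \<in> ?\<Omega>. \<forall>i<c * N. \<not> F i ` {..<k} \<subseteq> S}" for S
  have fin: "finite \<S>" and card\<S>: "card \<S> \<le> 2 ^ N"
  proof -
    have sub: "\<S> \<subseteq> Pow {..<N}"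
      by (auto simp: \<S>_def)
    then show "finite \<S>"
      by (rule finite_subset) simp
    show "card \<S> \<le> 2 ^ N"
      using card_mono[OF _ sub] by (simp add: card_Pow)
  qed
  have pos: "0 < card ?\<Omega>"
    using assms by (simp add: card_tuple_systems)
  have \<theta>: "0 \<le> ?\<theta>"
    using assms(2) by (simp add: power_le_one)
  have each: "real (card (X S)) \<le> real (card ?\<Omega>) * (1 / 4) ^ N" if "S \<in> \<S>" for S
  proof -
    have "real (card (X S)) \<le> real (card ?\<Omega>) * ?\<theta> ^ (c * N)"
      unfolding X_def using that assms(2) by (intro card_systems_missing_set) (auto simp: \<S>_def)
    also have "?\<theta> ^ (c * N) \<le> (1 / 4) ^ N"
      using power_mono[OF c, of N] \<theta> by (simp add: power_mult)
    finally show ?thesis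
      by (simp add: mult_left_mono)
  qed
  have union: "{F \<in> ?\<Omega>. \<exists>S\<subseteq>{..<N}. N \<le> r * card S \<and> (\<forall>i<c * N. \<not> F i ` {..<k} \<subseteq> S)}
      = (\<Union>S\<in>\<S>. X S)"
    by (auto simp: \<S>_def X_def)
  have "real (card (\<Union>S\<in>\<S>. X S)) \<le> (\<Sum>S\<in>\<S>. real (card (X S)))"
    using card_UN_le[OF fin, of X] by (metis of_nat_le_iff of_nat_sum)
  moreover have "\<dots> \<le> (\<Sum>S\<in>\<S>. real (card ?\<Omega>) * (1 / 4) ^ N)"
    by (intro sum_mono each)
  moreover have "\<dots> \<le> 2 ^ N * (real (card ?\<Omega>) * (1 / 4) ^ N)"
  proof -
    have "real (card \<S>) \<le> 2 ^ N"
      using card\<S> by (metis of_nat_le_iff of_nat_numeral of_nat_power)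
    then show ?thesis
      by (simp add: mult_right_mono)
  qed
  moreover have "2 ^ N * (real (card ?\<Omega>) * (1 / 4) ^ N) = real (card ?\<Omega>) * (1 / 2) ^ N"
    using power_mult_distrib[of 2 "1/4::real" N] by simp
  moreover have "(1 / 2 :: real) ^ N \<le> (1 / 2) ^ 2"
    using assms(3) by (intro power_decreasing) auto
  then have "real (card ?\<Omega>) * (1 / 2) ^ N \<le> real (card ?\<Omega>) * (1 / 4)"
    by (intro mult_left_mono) (auto simp: power2_eq_square)
  ultimately have "real (card {F \<in> ?\<Omega>. \<exists>S\<subseteq>{..<N}. N \<le> r * card S \<and>
      (\<forall>i<c * N. \<not> F i ` {..<k} \<subseteq> S)}) \<le> real (card ?\<Omega>) * (1 / 4)"
    unfolding union by linarith
  then show ?thesis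
    using pos by linarith
qed

definition short_cycles :: "nat \<Rightarrow> nat \<Rightarrow> (nat \<Rightarrow> nat \<Rightarrow> nat) \<Rightarrow> (nat \<times> nat \<times> nat) list set" where
  "short_cycles m k F = (\<Union>g\<in>{1, 2, 3}. {xs \<in> cycle_patterns m k g. closes F xs})"

text \<open>Fewer than half of the systems miss a large set, and by Markov's inequality at most half have more
  than twice the bound on the expected number of cycles of length at most 3.\<close>

lemma exists_sparse_dense_system:
  assumes "0 < r"
  obtains K c where "\<And>N. 2 \<le> N \<Longrightarrow> \<exists>F\<in>tuple_systems (c * N) k N.
    card (short_cycles (c * N) k F) \<le> K \<and>
    (\<forall>S\<subseteq>{..<N}. N \<le> r * card S \<longrightarrow> (\<exists>i<c * N. F i ` {..<k} \<subseteq> S))"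
proof -
  have "\<exists>c. (1 - (1 / real r) ^ k) ^ c < 1 / 4"
    using assms by (intro real_arch_pow_inv) auto
  then obtain c where c: "(1 - (1 / real r) ^ k) ^ c \<le> 1 / 4"
    by (meson less_imp_le)
  define K where "K = (\<Sum>g\<in>{1, 2, 3}. (c * k\<^sup>2) ^ g)"
  show ?thesis
  proof (rule that[of c "2 * K"])
    fix N :: nat assume N: "2 \<le> N"
    let ?\<Omega> = "tuple_systems (c * N) k N"
    let ?cyc = "\<lambda>F. card (short_cycles (c * N) k F)"
    define X1 where "X1 = {F \<in> ?\<Omega>. \<exists>S\<subseteq>{..<N}. N \<le> r * card S \<and> (\<forall>i<c * N. \<not> F i ` {..<k} \<subseteq> S)}"
    define X2 where "X2 = {F \<in> ?\<Omega>. 2 * K < ?cyc F}"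
    have "(\<Sum>F\<in>?\<Omega>. ?cyc F) \<le> (\<Sum>F\<in>?\<Omega>. \<Sum>g\<in>{1, 2, 3}. card {xs \<in> cycle_patterns (c * N) k g. closes F xs})"
      unfolding short_cycles_def by (intro sum_mono card_UN_le) simp
    also have "\<dots> = (\<Sum>g\<in>{1, 2, 3}. \<Sum>F\<in>?\<Omega>. card {xs \<in> cycle_patterns (c * N) k g. closes F xs})"
      by (rule sum.swap)
    also have "\<dots> \<le> (\<Sum>g\<in>{1, 2, 3}. (c * k\<^sup>2) ^ g * card ?\<Omega>)"
      using N by (intro sum_mono sum_closing_patterns) simp
    also have "\<dots> = K * card ?\<Omega>"
      by (simp only: K_def sum_distrib_right)
    finally have total: "(\<Sum>F\<in>?\<Omega>. ?cyc F) \<le> K * card ?\<Omega>" .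
    have "card X2 * (2 * K + 1) = (\<Sum>F\<in>X2. 2 * K + 1)"
      by simp
    also have "\<dots> \<le> (\<Sum>F\<in>X2. ?cyc F)"
      by (intro sum_mono) (simp add: X2_def)
    also have "\<dots> \<le> (\<Sum>F\<in>?\<Omega>. ?cyc F)"
      by (intro sum_mono2) (auto simp: X2_def finite_tuple_systems)
    finally have "card X2 * (2 * K + 1) \<le> K * card ?\<Omega>"
      using total by simp
    then have X2: "2 * card X2 \<le> card ?\<Omega>"
    proof (cases "K = 0")
      case False
      have "K * (2 * card X2) \<le> card X2 * (2 * K + 1)"
        by (simp add: algebra_simps)
      also have "\<dots> \<le> K * card ?\<Omega>"
        by fact
      finally show ?thesis
        using False by simp
    qed auto
    have X1: "2 * card X1 < card ?\<Omega>"
      unfolding X1_def using card_systems_missing_large_set[OF c assms N] .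
    have "\<not> ?\<Omega> \<subseteq> X1 \<union> X2"
    proof
      assume "?\<Omega> \<subseteq> X1 \<union> X2"
      then have "card ?\<Omega> \<le> card (X1 \<union> X2)"
        by (intro card_mono) (auto simp: X1_def X2_def finite_tuple_systems)
      then show False
        using card_Un_le[of X1 X2] X1 X2 by linarith
    qed
    then obtain F where F: "F \<in> ?\<Omega>" "F \<notin> X1" "F \<notin> X2"
      by blast
    show "\<exists>F\<in>?\<Omega>. ?cyc F \<le> 2 * K \<and>
        (\<forall>S\<subseteq>{..<N}. N \<le> r * card S \<longrightarrow> (\<exists>i<c * N. F i ` {..<k} \<subseteq> S))"
    proof (intro bexI[of _ F] conjI)
      show "?cyc F \<le> 2 * K"
        using F by (auto simp: X2_def)
      show "\<forall>S\<subseteq>{..<N}. N \<le> r * card S \<longrightarrow> (\<exists>i<c * N. F i ` {..<k} \<subseteq> S)"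
        using F by (fastforce simp: X1_def)
    qed (rule F)
  qed
qed

section \<open>Erdos-Rogers graphs\<close>

definition shadow :: "nat \<Rightarrow> nat \<Rightarrow> (nat \<Rightarrow> nat \<Rightarrow> nat) \<Rightarrow> nat set \<Rightarrow> nat struc" where
  "shadow m k F V = \<lparr>univ = V,
     edge_rel = (\<lambda>u v. u \<noteq> v \<and> (\<exists>i<m. u \<in> F i ` {..<k} \<and> v \<in> F i ` {..<k}))\<rparr>"

text \<open>A clique of size \<open>k + 1\<close> does not fit into one hyperedge. Take two of its vertices \<open>u\<close>, \<open>v\<close> in a
  hyperedge \<open>i\<close> and a third vertex \<open>w\<close> outside it; the hyperedges that cover \<open>uw\<close> and \<open>vw\<close> are not \<open>i\<close>, and
  together with \<open>i\<close> they form a cycle of length 2 or 3 through \<open>u\<close>.\<close>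

lemma shadow_clique_free:
  assumes "0 < k" and hit: "\<And>xs. xs \<in> short_cycles m k F \<Longrightarrow> entry F (hd xs) \<notin> V"
  shows "clique_free (Suc k) (shadow m k F V) V"
  unfolding clique_free_def
proof (intro allI impI notI)
  fix Q assume Q: "Q \<subseteq> V" "finite Q" "card Q = Suc k" and "is_clique (shadow m k F V) Q"
  then have adj: "\<exists>i<m. u \<in> F i ` {..<k} \<and> v \<in> F i ` {..<k}" if "u \<in> Q" "v \<in> Q" "u \<noteq> v" for u v
    using that by (auto simp: is_clique_def shadow_def)
  have no_cycle: "\<not> closes F xs" if "xs \<in> cycle_patterns m k g" "g \<in> {1, 2, 3}" "entry F (hd xs) \<in> V" for xs g
    using hit[of xs] that by (auto simp: short_cycles_def)
  obtain u where u: "u \<in> Q"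
    using Q by force
  obtain v where v: "v \<in> Q" "v \<noteq> u"
  proof -
    have "\<not> Q \<subseteq> {u}"
      using Q assms(1) card_mono[of "{u}" Q] by auto
    then show ?thesis
      using that by blast
  qed
  obtain i iu iv where i: "i < m" "iu < k" "iv < k" "F i iu = u" "F i iv = v"
    using adj[OF u v(1)] v(2) by auto
  have "\<not> Q \<subseteq> F i ` {..<k}"
    using card_mono[of "F i ` {..<k}" Q] card_image_le[of "{..<k}" "F i"] Q by auto
  then obtain w where w: "w \<in> Q" "w \<notin> F i ` {..<k}"
    by blast
  have wuv: "w \<noteq> u" "w \<noteq> v"
    using w i by auto
  obtain j jw ju where j: "j < m" "jw < k" "ju < k" "F j jw = w" "F j ju = u"
    using adj[OF w(1) u wuv(1)] by auto
  obtain l lv lw where l: "l < m" "lv < k" "lw < k" "F l lv = v" "F l lw = w"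
    using adj[OF v(1) w(1)] wuv(2) by auto
  have ij: "i \<noteq> j" and il: "i \<noteq> l"
    using w(2) j l by (metis imageI lessThan_iff)+
  have pos: "iu \<noteq> iv" "ju \<noteq> jw" "lv \<noteq> lw"
    using i j l v(2) wuv by auto
  show False
  proof (cases "j = l")
    case True
    have "lv \<noteq> ju"
      using True j l v(2) by auto
    then have "[(i, iu, iv), (l, lv, ju)] \<in> cycle_patterns m k 2"
      using True i j l il pos by (auto simp: cycle_patterns_def)
    moreover have "closes F [(i, iu, iv), (l, lv, ju)]"
      using True i j l by (auto simp: closes_def entry_def exit_def less_Suc_eq)
    ultimately show False
      using no_cycle[of "[(i, iu, iv), (l, lv, ju)]" 2] Q(1) u i by (auto simp: entry_def)
  next
    case False
    then have "[(i, iu, iv), (l, lv, lw), (j, jw, ju)] \<in> cycle_patterns m k 3"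
      using i j l ij il pos by (auto simp: cycle_patterns_def)
    moreover have "closes F [(i, iu, iv), (l, lv, lw), (j, jw, ju)]"
      using i j l by (auto simp: closes_def entry_def exit_def less_Suc_eq)
    ultimately show False
      using no_cycle[of "[(i, iu, iv), (l, lv, lw), (j, jw, ju)]" 3] Q(1) u i
      by (auto simp: entry_def)
  qed
qed

text \<open>Cycles of length 1 are excluded as well, so a hyperedge in \<open>V\<close> has \<open>k\<close> different vertices.\<close>

lemma tuple_in_shadow:
  assumes hit: "\<And>xs. xs \<in> short_cycles m k F \<Longrightarrow> entry F (hd xs) \<notin> V"
    and "i < m" "F i ` {..<k} \<subseteq> V"
  shows "is_clique (shadow m k F V) (F i ` {..<k})" "card (F i ` {..<k}) = k"
proof -
  show "is_clique (shadow m k F V) (F i ` {..<k})"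
    using assms(2) by (auto simp: is_clique_def shadow_def)
  have "inj_on (F i) {..<k}"
  proof (rule inj_onI, rule ccontr)
    fix a b assume ab: "a \<in> {..<k}" "b \<in> {..<k}" "F i a = F i b" "a \<noteq> b"
    then have "[(i, a, b)] \<in> cycle_patterns m k 1"
      using assms(2) by (auto simp: cycle_patterns_def)
    moreover have "closes F [(i, a, b)]"
      using ab by (auto simp: closes_def entry_def exit_def)
    ultimately have "[(i, a, b)] \<in> short_cycles m k F"
      by (auto simp: short_cycles_def)
    from hit[OF this] show False
      using assms(3) ab by (auto simp: entry_def)
  qed
  then show "card (F i ` {..<k}) = k"
    by (simp add: card_image)
qed

text \<open>One vertex is deleted for each short cycle. These are boundedly many, so with \<open>N\<close> large at least half of
  the vertices survive, which is why the hypergraph is chosen for \<open>2 * q\<close> in place of \<open>q\<close>.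
  Deleting vertices in place of hyperedges keeps every hyperedge inside a set of surviving vertices
  available, so large sets still contain cliques of size \<open>k\<close>.\<close>

theorem erdos_rogers:
  assumes "0 < k" "0 < q"
  obtains G :: "nat struc" where "finite (univ G)" "univ G \<noteq> {}" "is_graph G"
    "clique_free (Suc k) G (univ G)"
    "\<And>S. S \<subseteq> univ G \<Longrightarrow> clique_free k G S \<Longrightarrow> q * card S \<le> card (univ G)"
proof -
  have "0 < 2 * q"
    using assms by simp
  then obtain K c where Kc: "\<And>N. 2 \<le> N \<Longrightarrow> \<exists>F\<in>tuple_systems (c * N) k N.
    card (short_cycles (c * N) k F) \<le> K \<and>
    (\<forall>S\<subseteq>{..<N}. N \<le> 2 * q * card S \<longrightarrow> (\<exists>i<c * N. F i ` {..<k} \<subseteq> S))"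
    using exists_sparse_dense_system[of "2 * q"] by metis
  define N where "N = 2 * K + 2"
  define m where "m = c * N"
  obtain F where few: "card (short_cycles m k F) \<le> K"
    and dense: "\<And>S. S \<subseteq> {..<N} \<Longrightarrow> N \<le> 2 * q * card S \<Longrightarrow> \<exists>i<m. F i ` {..<k} \<subseteq> S"
    using Kc[of N] by (auto simp: N_def m_def)
  define B where "B = (\<lambda>xs. entry F (hd xs)) ` short_cycles m k F"
  define V where "V = {..<N} - B"
  have hit: "entry F (hd xs) \<notin> V" if "xs \<in> short_cycles m k F" for xs
    using that by (auto simp: V_def B_def)
  have fin: "finite (short_cycles m k F)"
    by (simp add: short_cycles_def finite_cycle_patterns)
  have "card B \<le> K"
    using card_image_le[OF fin, of "\<lambda>xs. entry F (hd xs)"] few by (simp add: B_def)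
  moreover have "N - card B \<le> card V"
    using diff_card_le_card_Diff[of B "{..<N}"] fin by (simp add: V_def B_def)
  ultimately have V: "N \<le> 2 * card V" "0 < card V"
    by (auto simp: N_def)
  show ?thesis
  proof (rule that[of "shadow m k F V"])
    show "finite (univ (shadow m k F V))" "univ (shadow m k F V) \<noteq> {}"
      using V(2) by (auto simp: shadow_def V_def card_gt_0_iff)
    show "is_graph (shadow m k F V)"
      by (auto simp: is_graph_def shadow_def)
    show "clique_free (Suc k) (shadow m k F V) (univ (shadow m k F V))"
      using shadow_clique_free[OF assms(1) hit] by (simp add: shadow_def)
    fix S assume S: "S \<subseteq> univ (shadow m k F V)" "clique_free k (shadow m k F V) S"
    then have SV: "S \<subseteq> V" "S \<subseteq> {..<N}"
      by (auto simp: shadow_def V_def)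
    have "\<not> N \<le> 2 * q * card S"
    proof
      assume "N \<le> 2 * q * card S"
      then obtain i where i: "i < m" "F i ` {..<k} \<subseteq> S"
        using dense[OF SV(2)] by blast
      then show False
        using S(2) tuple_in_shadow[OF hit i(1)] SV(1) by (auto simp: clique_free_def)
    qed
    then show "q * card S \<le> card (univ (shadow m k F V))"
      using V(1) by (simp add: shadow_def)
  qed
qed

section \<open>The extension property and quantifier elimination\<close>

definition qf_equiv ::
  "nat set \<Rightarrow> 'a struc \<Rightarrow> (nat \<Rightarrow> 'a) \<Rightarrow> 'b struc \<Rightarrow> (nat \<Rightarrow> 'b) \<Rightarrow> bool" where
  "qf_equiv I G v G' w \<longleftrightarrow> (\<forall>i\<in>I. \<forall>j\<in>I.
     (v i = v j \<longleftrightarrow> w i = w j) \<and> (edge_rel G (v i) (v j) \<longleftrightarrow> edge_rel G' (w i) (w j)))"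

text \<open>The universal theory and the extension axioms of the random graph without cliques of size \<open>r + 1\<close>.\<close>

definition henson :: "nat \<Rightarrow> 'a struc \<Rightarrow> bool" where
  "henson r G \<longleftrightarrow> is_graph G \<and> clique_free (Suc r) G (univ G) \<and>
     (\<forall>A B. finite A \<longrightarrow> finite B \<longrightarrow> A \<subseteq> univ G \<longrightarrow> B \<subseteq> univ G \<longrightarrow> A \<inter> B = {} \<longrightarrow> clique_free r G A \<longrightarrow>
        (\<exists>c\<in>univ G. c \<notin> A \<union> B \<and> (\<forall>a\<in>A. edge_rel G c a) \<and> (\<forall>b\<in>B. \<not> edge_rel G c b)))"

lemma qf_equiv_sym: "qf_equiv I G v G' w \<Longrightarrow> qf_equiv I G' w G v"
  by (auto simp: qf_equiv_def)

lemma qf_equiv_mono: "qf_equiv I G v G' w \<Longrightarrow> J \<subseteq> I \<Longrightarrow> qf_equiv J G v G' w"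
  unfolding qf_equiv_def by blast

lemma is_graph_commute:
  "is_graph G \<Longrightarrow> a \<in> univ G \<Longrightarrow> b \<in> univ G \<Longrightarrow> edge_rel G a b \<longleftrightarrow> edge_rel G b a"
  unfolding is_graph_def by blast

lemma clique_free_mono: "clique_free r G X \<Longrightarrow> Y \<subseteq> X \<Longrightarrow> clique_free r G Y"
  unfolding clique_free_def by blast

lemma clique_free_empty: "0 < r \<Longrightarrow> clique_free r G {}"
  by (auto simp: clique_free_def)

lemma clique_free_few: "finite X \<Longrightarrow> card X < r \<Longrightarrow> clique_free r G X"
  unfolding clique_free_def by (metis card_mono not_le)

lemma clique_free_independent:
  assumes "1 < r" "\<And>x y. x \<in> X \<Longrightarrow> y \<in> X \<Longrightarrow> x \<noteq> y \<Longrightarrow> \<not> edge_rel G x y"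
  shows "clique_free r G X"
  unfolding clique_free_def
proof (intro allI impI notI)
  fix Q assume Q: "Q \<subseteq> X" "finite Q" "card Q = r" "is_clique G Q"
  then obtain x y where "x \<in> Q" "y \<in> Q" "x \<noteq> y"
    using assms(1) card_le_Suc0_iff_eq[of Q] by fastforce
  moreover from this have "edge_rel G x y"
    using Q(4) by (simp add: is_clique_def)
  ultimately show False
    using Q(1) assms(2) by blast
qed

text \<open>A clique of size \<open>r\<close> among the neighbours of \<open>a\<close> becomes one of size \<open>r + 1\<close> when \<open>a\<close> is added.\<close>

lemma clique_free_neighbours:
  assumes "is_graph G" "clique_free (Suc r) G (univ G)" "a \<in> univ G" "X \<subseteq> univ G"
    and adj: "\<And>x. x \<in> X \<Longrightarrow> edge_rel G a x"
  shows "clique_free r G X"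
  unfolding clique_free_def
proof (intro allI impI notI)
  fix Q assume Q: "Q \<subseteq> X" "finite Q" "card Q = r" "is_clique G Q"
  have "a \<notin> Q"
    using assms Q(1) by (auto simp: is_graph_def)
  moreover have "edge_rel G a u" "edge_rel G u a" if "u \<in> Q" for u
    using that Q(1) assms adj[of u] unfolding is_graph_def by blast+
  then have "is_clique G (insert a Q)"
    using Q(4) by (auto simp: is_clique_def)
  ultimately show False
    using assms(2,3,4) Q unfolding clique_free_def
    by (auto dest!: spec[of _ "insert a Q"])
qed

lemma clique_free_qf_equiv:
  assumes eq: "qf_equiv I G v G' w" and "J \<subseteq> I" and free: "clique_free r G (v ` J)"
  shows "clique_free r G' (w ` J)"
  unfolding clique_free_def
proof (intro allI impI notI)
  fix Q assume Q: "Q \<subseteq> w ` J" "finite Q" "card Q = r" "is_clique G' Q"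
  obtain K where K: "K \<subseteq> J" "inj_on w K" "Q = w ` K"
    using Q(1) by (metis subset_image_inj)
  have "inj_on v K"
    using K eq assms(2) by (auto simp: inj_on_def qf_equiv_def subset_iff)
  then have "card (v ` K) = r"
    using K Q(3) by (simp add: card_image)
  moreover have "finite (v ` K)"
    using K Q(2) by (simp add: finite_image_iff)
  moreover have "is_clique G (v ` K)"
    using K Q(4) eq assms(2) unfolding is_clique_def qf_equiv_def by (auto simp: subset_iff)
  moreover have "v ` K \<subseteq> v ` J"
    using K by blast
  ultimately show False
    using free by (auto simp: clique_free_def)
qed

text \<open>The step of the back-and-forth argument. A new point \<open>a\<close> has a clique-free set of neighbours among the
  points already matched, and this set is clique-free also on the other side, so an extension axiom
  provides a partner for \<open>a\<close>. The structure that \<open>a\<close> comes from may be any clique-free graph;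
  the finite case of this gives \<open>embed_finite_graph\<close>.\<close>

lemma extend_qf_equiv:
  assumes G: "is_graph G" "clique_free (Suc r) G (univ G)" and G': "henson r G'"
    and "finite I" "v ` I \<subseteq> univ G" "w ` I \<subseteq> univ G'" and eq: "qf_equiv I G v G' w"
    and a: "a \<in> univ G" and "k \<notin> I"
  shows "\<exists>a'\<in>univ G'. qf_equiv (insert k I) G (v(k := a)) G' (w(k := a'))"
proof (cases "a \<in> v ` I")
  case True
  then obtain i where i: "i \<in> I" "v i = a"
    by blast
  have "edge_rel G a a \<longleftrightarrow> edge_rel G' (w i) (w i)"
    using eq i unfolding qf_equiv_def by blast
  then have "qf_equiv (insert k I) G (v(k := a)) G' (w(k := w i))"
    using eq i \<open>k \<notin> I\<close> by (auto simp: qf_equiv_def)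
  then show ?thesis
    using i assms(6) by blast
next
  case False
  have graph': "is_graph G'"
    using G' by (simp add: henson_def)
  define J where "J = {i \<in> I. edge_rel G a (v i)}"
  have J: "J \<subseteq> I"
    by (auto simp: J_def)
  have "clique_free r G (v ` J)"
    by (rule clique_free_neighbours[OF G a]) (use assms(5) in \<open>auto simp: J_def\<close>)
  then have "clique_free r G' (w ` J)"
    by (rule clique_free_qf_equiv[OF eq J])
  moreover have "w ` J \<inter> w ` (I - J) = {}"
    using eq by (fastforce simp: qf_equiv_def J_def)
  moreover have "finite (w ` J)" "finite (w ` (I - J))" "w ` J \<subseteq> univ G'" "w ` (I - J) \<subseteq> univ G'"
    using assms(4,6) J by (auto intro: finite_subset)
  ultimately obtain c where c: "c \<in> univ G'" "c \<notin> w ` J \<union> w ` (I - J)"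
    "\<forall>b\<in>w ` J. edge_rel G' c b" "\<forall>b\<in>w ` (I - J). \<not> edge_rel G' c b"
    using G' unfolding henson_def by metis
  have fresh: "c \<noteq> w i" "v i \<noteq> a" if "i \<in> I" for i
    using c(2) that False by auto
  have adj: "edge_rel G a (v i) \<longleftrightarrow> edge_rel G' c (w i)" if "i \<in> I" for i
    using c(3,4) that by (auto simp: J_def)
  have sym: "edge_rel G (v i) a \<longleftrightarrow> edge_rel G a (v i)"
    "edge_rel G' (w i) c \<longleftrightarrow> edge_rel G' c (w i)" if "i \<in> I" for i
    using assms(5,6) a c(1) that is_graph_commute[OF G(1)] is_graph_commute[OF graph'] by blast+
  have irr: "\<not> edge_rel G a a" "\<not> edge_rel G' c c"
    using G(1) graph' a c(1) unfolding is_graph_def by blast+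
  have "qf_equiv (insert k I) G (v(k := a)) G' (w(k := c))"
    unfolding qf_equiv_def
  proof (intro ballI)
    fix i j assume ij: "i \<in> insert k I" "j \<in> insert k I"
    have "(v i = v j \<longleftrightarrow> w i = w j) \<and> (edge_rel G (v i) (v j) \<longleftrightarrow> edge_rel G' (w i) (w j))"
      if "i \<noteq> k" "j \<noteq> k"
      using eq ij that unfolding qf_equiv_def by blast
    then show "((v(k := a)) i = (v(k := a)) j \<longleftrightarrow> (w(k := c)) i = (w(k := c)) j) \<and>
        (edge_rel G ((v(k := a)) i) ((v(k := a)) j) \<longleftrightarrow> edge_rel G' ((w(k := c)) i) ((w(k := c)) j))"
      using ij fresh[of i] fresh[of j] adj sym irr by (cases "i = k"; cases "j = k") auto
  qed
  then show ?thesis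
    using c(1) by blast
qed

lemma embed_finite_graph:
  assumes "henson r G'" "is_graph G" "clique_free (Suc r) G (univ G)"
    and "finite (univ G)"
  obtains f :: "nat \<Rightarrow> 'b" where "f ` univ G \<subseteq> univ G'" "qf_equiv (univ G) G id G' f"
proof -
  have "\<exists>f. f ` I \<subseteq> univ G' \<and> qf_equiv I G id G' f" if "I \<subseteq> univ G" for I
    using finite_subset[OF that assms(4)] that
  proof (induction I rule: finite_induct)
    case empty
    then show ?case
      by (auto simp: qf_equiv_def)
  next
    case (insert k I)
    then obtain f where f: "f ` I \<subseteq> univ G'" "qf_equiv I G id G' f"
      by blast
    obtain a' where a': "a' \<in> univ G'" "qf_equiv (insert k I) G (id(k := k)) G' (f(k := a'))"
      using extend_qf_equiv[OF assms(2,3,1) insert(1) _ f(1,2), of k k] insert by auto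
    have "id(k := k) = (id :: nat \<Rightarrow> nat)"
      by auto
    moreover have "(f(k := a')) ` insert k I \<subseteq> univ G'"
      using a'(1) f(1) by auto
    ultimately show ?case
      using a'(2) by metis
  qed
  then show ?thesis
    using that by blast
qed

lemma finite_fv: "finite (fv \<phi>)"
  by (induction \<phi>) auto

lemma sat_cong: "(\<And>i. i \<in> fv \<phi> \<Longrightarrow> v i = w i) \<Longrightarrow> sat G v \<phi> \<longleftrightarrow> sat G w \<phi>"
proof (induction \<phi> arbitrary: v w)
  case (FEx k \<phi>)
  have "sat G (v(k := a)) \<phi> \<longleftrightarrow> sat G (w(k := a)) \<phi>" for a
    by (rule FEx.IH) (use FEx.prems in auto)
  then show ?case
    by simp
next
  case (FNeg \<phi>)
  have "sat G v \<phi> \<longleftrightarrow> sat G w \<phi>"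
    by (rule FNeg.IH) (use FNeg.prems in simp)
  then show ?case
    by simp
next
  case (FConj \<phi> \<psi>)
  have "sat G v \<phi> \<longleftrightarrow> sat G w \<phi>"
    by (rule FConj.IH(1)) (use FConj.prems in simp)
  moreover have "sat G v \<psi> \<longleftrightarrow> sat G w \<psi>"
    by (rule FConj.IH(2)) (use FConj.prems in simp)
  ultimately show ?case
    by simp
qed auto

text \<open>Quantifier elimination. Both structures satisfy the extension axioms, so a witness of a quantifier on either
  side is matched on the other side by \<open>extend_qf_equiv\<close>.\<close>

theorem sat_qf_equiv:
  assumes "henson r G" "henson r G'"
    and "v ` fv \<phi> \<subseteq> univ G" "w ` fv \<phi> \<subseteq> univ G'" "qf_equiv (fv \<phi>) G v G' w"
  shows "sat G v \<phi> \<longleftrightarrow> sat G' w \<phi>"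
  using assms(3-)
proof (induction \<phi> arbitrary: v w)
  case (FConj \<phi> \<psi>)
  have "sat G v \<phi> \<longleftrightarrow> sat G' w \<phi>" "sat G v \<psi> \<longleftrightarrow> sat G' w \<psi>"
    using FConj.prems by (intro FConj.IH; auto elim: qf_equiv_mono)+
  then show ?case
    by simp
next
  case (FEx k \<phi>)
  let ?I = "fv \<phi> - {k}"
  have I: "finite ?I" "k \<notin> ?I" and sub: "fv \<phi> \<subseteq> insert k ?I"
    by (auto simp: finite_fv)
  have v: "v ` ?I \<subseteq> univ G" and w: "w ` ?I \<subseteq> univ G'" and eq: "qf_equiv ?I G v G' w"
    using FEx.prems by auto
  have step: "sat G (v(k := a)) \<phi> \<longleftrightarrow> sat G' (w(k := a')) \<phi>"
    if "a \<in> univ G" "a' \<in> univ G'" "qf_equiv (insert k ?I) G (v(k := a)) G' (w(k := a'))" for a a'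
    using that v w by (intro FEx.IH qf_equiv_mono[OF that(3) sub]) auto
  show ?case
  proof
    assume "sat G v (FEx k \<phi>)"
    then obtain a where a: "a \<in> univ G" "sat G (v(k := a)) \<phi>"
      by auto
    have "is_graph G" "clique_free (Suc r) G (univ G)"
      using assms(1) by (auto simp: henson_def)
    from extend_qf_equiv[OF this assms(2) I(1) v w eq a(1) I(2)] step a
    show "sat G' w (FEx k \<phi>)"
      by auto
  next
    assume "sat G' w (FEx k \<phi>)"
    then obtain a where a: "a \<in> univ G'" "sat G' (w(k := a)) \<phi>"
      by auto
    have "is_graph G'" "clique_free (Suc r) G' (univ G')"
      using assms(2) by (auto simp: henson_def)
    from extend_qf_equiv[OF this assms(1) I(1) w v qf_equiv_sym[OF eq] a(1) I(2)] step a
    show "sat G v (FEx k \<phi>)"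
      by (auto dest: qf_equiv_sym)
  qed
qed (auto simp: qf_equiv_def)

section \<open>Transfer of the extension property between models\<close>

lemma models_theory_of_iff:
  assumes "models G (theory_of H)" "fv \<sigma> = {}"
  shows "holds G (\<sigma>, []) [] \<longleftrightarrow> holds H (\<sigma>, []) []"
proof -
  have "holds G (\<sigma>, []) []" if "holds H (\<sigma>, []) []"
    using assms that by (simp add: models_def theory_of_def)
  moreover have "holds G (FNeg \<sigma>, []) []" if "\<not> holds H (\<sigma>, []) []"
  proof -
    have "FNeg \<sigma> \<in> theory_of H"
      using assms(2) that by (simp add: theory_of_def)
    then show ?thesis
      using assms(1) unfolding models_def by blast
  qed
  ultimately show ?thesis
    by auto
qed

lemma fv_foldr_FEx: "fv (foldr FEx ks \<phi>) = fv \<phi> - set ks"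
  by (induction ks) auto

lemma sat_foldr_FEx:
  "sat G v (foldr FEx ks \<phi>) \<longleftrightarrow>
    (\<exists>w. (\<forall>i. i \<notin> set ks \<longrightarrow> w i = v i) \<and> (\<forall>i\<in>set ks. w i \<in> univ G) \<and> sat G w \<phi>)"
proof (induction ks arbitrary: v)
  case Nil
  have "w = v" if "\<forall>i. w i = v i" for w
    using that by auto
  then show ?case
    by auto
next
  case (Cons k ks)
  show ?case (is "?L \<longleftrightarrow> ?R")
  proof
    assume ?L
    then obtain a w where aw: "a \<in> univ G" "\<forall>i. i \<notin> set ks \<longrightarrow> w i = (v(k := a)) i"
      "\<forall>i\<in>set ks. w i \<in> univ G" "sat G w \<phi>"
      using Cons.IH by auto
    have "w k \<in> univ G"
      using aw by (cases "k \<in> set ks") auto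
    then show ?R
      using aw by (intro exI[of _ w]) auto
  next
    assume ?R
    then obtain w where w: "\<forall>i. i \<notin> set (k # ks) \<longrightarrow> w i = v i"
      "\<forall>i\<in>set (k # ks). w i \<in> univ G" "sat G w \<phi>"
      by blast
    have "sat G (v(k := w k)) (foldr FEx ks \<phi>)"
      unfolding Cons.IH using w by (intro exI[of _ w]) auto
    then show ?L
      using w(2) by auto
  qed
qed

text \<open>The existential closure of \<open>\<phi>\<close> is a sentence, and \<open>theory_of H\<close> is complete. The variables range over a set
  \<open>I\<close> that may be larger than \<open>fv \<phi>\<close>, because a tuple is sometimes transferred with a formula that does
  not mention all its entries.\<close>

lemma transfer_sat:
  assumes "models G (theory_of H)" "finite I" "fv \<phi> \<subseteq> I" "v ` I \<subseteq> univ G" "sat G v \<phi>"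
  obtains w where "w ` I \<subseteq> univ H" "sat H w \<phi>"
proof -
  define ks where "ks = sorted_list_of_set I"
  have ks: "set ks = I"
    using assms(2) by (simp add: ks_def)
  define e :: "nat \<Rightarrow> 'a" where "e = (\<lambda>i. ([] @ []) ! i)"
  define v' where "v' i = (if i \<in> I then v i else e i)" for i
  have "sat G v \<phi> \<longleftrightarrow> sat G v' \<phi>"
    by (rule sat_cong) (use assms(3) in \<open>auto simp: v'_def\<close>)
  then have "sat G v' \<phi>"
    using assms(5) by simp
  then have "sat G e (foldr FEx ks \<phi>)"
    unfolding sat_foldr_FEx using assms(4) by (intro exI[of _ v']) (auto simp: ks v'_def)
  then have "holds G (foldr FEx ks \<phi>, []) []"
    by (simp add: e_def)
  then have "holds H (foldr FEx ks \<phi>, []) []"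
    using models_theory_of_iff[OF assms(1)] assms(3) by (auto simp: fv_foldr_FEx ks)
  then show ?thesis
    using that by (auto simp: sat_foldr_FEx ks image_subset_iff)
qed

text \<open>The empty conjunction has to be a formula without free variables, so it cannot simply be \<open>x = x\<close>.\<close>

fun conj_list :: "fm list \<Rightarrow> fm" where
  "conj_list [] = FNeg (FEx 0 (FNeg (FEq 0 0)))"
| "conj_list (\<phi> # \<phi>s) = FConj \<phi> (conj_list \<phi>s)"

lemma sat_conj_list: "sat G v (conj_list \<phi>s) \<longleftrightarrow> (\<forall>\<phi>\<in>set \<phi>s. sat G v \<phi>)"
  by (induction \<phi>s) auto

lemma fv_conj_list: "fv (conj_list \<phi>s) = (\<Union>\<phi>\<in>set \<phi>s. fv \<phi>)"
  by (induction \<phi>s) auto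

definition literal :: "bool \<Rightarrow> fm \<Rightarrow> fm" where
  "literal b \<phi> = (if b then \<phi> else FNeg \<phi>)"

definition diagram :: "'a struc \<Rightarrow> (nat \<Rightarrow> 'a) \<Rightarrow> nat \<Rightarrow> fm" where
  "diagram G v n = conj_list
     ([literal (v i = v j) (FEq i j). i \<leftarrow> [0..<n], j \<leftarrow> [0..<n]] @
      [literal (edge_rel G (v i) (v j)) (FEdge i j). i \<leftarrow> [0..<n], j \<leftarrow> [0..<n]])"

lemma fv_diagram: "fv (diagram G v n) \<subseteq> {..<n}"
  by (auto simp: diagram_def fv_conj_list literal_def split: if_splits)

lemma sat_literal: "sat G v (literal b \<phi>) \<longleftrightarrow> (sat G v \<phi> \<longleftrightarrow> b)"
  by (auto simp: literal_def)

lemma sat_diagram: "sat G' w (diagram G v n) \<longleftrightarrow> qf_equiv {..<n} G v G' w"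
  by (simp add: diagram_def sat_conj_list sat_literal qf_equiv_def ball_Un lessThan_atLeast0) auto

text \<open>Conjoining the diagram of a tuple to \<open>\<phi>\<close> transfers \<open>\<phi>\<close> together with the isomorphism type of the tuple. So an
  axiom of \<open>henson\<close> that fails in \<open>G\<close> fails at a finite tuple, and at its copy in \<open>H\<close>.\<close>

lemma transfer_tuple:
  assumes "models G (theory_of H)" "fv \<phi> \<subseteq> {..<n}" "v ` {..<n} \<subseteq> univ G" "sat G v \<phi>"
  obtains w where "w ` {..<n} \<subseteq> univ H" "qf_equiv {..<n} G v H w" "sat H w \<phi>"
proof -
  have "sat G v (FConj (diagram G v n) \<phi>)"
    using assms(4) by (simp add: sat_diagram) (simp add: qf_equiv_def)
  moreover have "fv (FConj (diagram G v n) \<phi>) \<subseteq> {..<n}"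
    using fv_diagram assms(2) by simp
  ultimately obtain w where "w ` {..<n} \<subseteq> univ H" "sat H w (FConj (diagram G v n) \<phi>)"
    using transfer_sat[OF assms(1) finite_lessThan _ assms(3)] by blast
  then show ?thesis
    using that by (auto simp: sat_diagram)
qed

text \<open>Some new vertex is joined to the first \<open>p\<close> of the variables \<open>0, ..., n - 1\<close> and to none of the others.\<close>

definition extension_formula :: "nat \<Rightarrow> nat \<Rightarrow> fm" where
  "extension_formula p n = FEx n (conj_list
     ([FEdge n i. i \<leftarrow> [0..<p]] @ [FNeg (FEdge n i). i \<leftarrow> [p..<n]] @ [FNeg (FEq n i). i \<leftarrow> [0..<n]]))"

lemma fv_extension_formula: "p \<le> n \<Longrightarrow> fv (extension_formula p n) \<subseteq> {..<n}"
  by (auto simp: extension_formula_def fv_conj_list)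

lemma sat_extension_formula:
  assumes "p \<le> n"
  shows "sat G v (extension_formula p n) \<longleftrightarrow> (\<exists>c\<in>univ G. c \<notin> v ` {..<n} \<and>
    (\<forall>a\<in>v ` {..<p}. edge_rel G c a) \<and> (\<forall>b\<in>v ` {p..<n}. \<not> edge_rel G c b))"
proof -
  have fresh: "(v(n := c)) i = v i" if "i < n" for c i
    using that by simp
  show ?thesis
    unfolding extension_formula_def sat.simps(5) sat_conj_list using assms
    by (intro bex_cong refl) (simp add: ball_Un, auto)
qed

theorem henson_elementary:
  assumes H: "henson r H" and GH: "models G (theory_of H)"
  shows "henson r G"
proof -
  have transfer: "\<exists>w. w ` {..<n} \<subseteq> univ H \<and> qf_equiv {..<n} G v H w" if "v ` {..<n} \<subseteq> univ G" for v n
    using transfer_tuple[OF GH, of "conj_list []" n v] that by fastforce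
  have graphH: "is_graph H" and freeH: "clique_free (Suc r) H (univ H)"
    using H by (auto simp: henson_def)
  have graph: "\<not> edge_rel G a a \<and> (edge_rel G a b \<longrightarrow> edge_rel G b a)" if "a \<in> univ G" "b \<in> univ G" for a b
  proof -
    have "(\<lambda>i. if i = 0 then a else b) ` {..<2} \<subseteq> univ G"
      using that by auto
    then obtain w where w: "w ` {..<2} \<subseteq> univ H"
      "qf_equiv {..<2} G (\<lambda>i. if i = 0 then a else b) H w"
      using transfer by blast
    have mem: "w 0 \<in> univ H" "w 1 \<in> univ H"
      using w(1) by auto
    have "edge_rel G (if i = 0 then a else b) (if j = 0 then a else b) \<longleftrightarrow> edge_rel H (w i) (w j)"
      if "i < 2" "j < 2" for i j
      using w(2) that unfolding qf_equiv_def by blast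
    from this[of 0 0] this[of 0 1] this[of 1 0]
    have "edge_rel G a a \<longleftrightarrow> edge_rel H (w 0) (w 0)" "edge_rel G a b \<longleftrightarrow> edge_rel H (w 0) (w 1)"
      "edge_rel G b a \<longleftrightarrow> edge_rel H (w 1) (w 0)"
      by simp_all
    then show ?thesis
      using mem graphH by (auto simp: is_graph_def)
  qed
  then have "is_graph G"
    by (auto simp: is_graph_def)
  moreover have "clique_free (Suc r) G (univ G)"
    unfolding clique_free_def
  proof (intro allI impI notI)
    fix Q assume Q: "Q \<subseteq> univ G" "finite Q" "card Q = Suc r" "is_clique G Q"
    obtain h where "bij_betw h {0..<card Q} Q"
      using ex_bij_betw_nat_finite[OF Q(2)] by blast
    then have h: "h ` {..<Suc r} = Q"
      using Q(3) by (simp add: bij_betw_def lessThan_atLeast0)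
    then obtain w where w: "w ` {..<Suc r} \<subseteq> univ H" "qf_equiv {..<Suc r} G h H w"
      using transfer[of h "Suc r"] Q(1) by blast
    have "clique_free (Suc r) G (h ` {..<Suc r})"
      by (rule clique_free_qf_equiv[OF qf_equiv_sym[OF w(2)] order_refl])
        (rule clique_free_mono[OF freeH w(1)])
    then show False
      using Q h by (auto simp: clique_free_def)
  qed
  moreover have "\<exists>c\<in>univ G. c \<notin> A \<union> B \<and> (\<forall>a\<in>A. edge_rel G c a) \<and> (\<forall>b\<in>B. \<not> edge_rel G c b)"
    if AB: "finite A" "finite B" "A \<subseteq> univ G" "B \<subseteq> univ G" "A \<inter> B = {}"
      and freeA: "clique_free r G A" for A B
  proof -
    obtain as where as: "set as = A"
      using finite_list[OF AB(1)] by blast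
    obtain bs where bs: "set bs = B"
      using finite_list[OF AB(2)] by blast
    define p where "p = length as"
    define n where "n = length (as @ bs)"
    define v where "v i = (as @ bs) ! i" for i
    have pn: "p \<le> n"
      by (simp add: p_def n_def)
    have vA: "v ` {..<p} = A"
      using as by (auto simp: v_def p_def nth_append in_set_conv_nth image_iff)
    have vn: "v ` {..<n} = A \<union> B"
      using as bs nth_image[of n "as @ bs"] by (simp add: v_def[abs_def] n_def lessThan_atLeast0)
    have vB: "v ` {p..<n} = B"
    proof -
      have "v ` {p..<n} = (\<lambda>i. bs ! i) ` {..<length bs}"
      proof (rule set_eqI, rule iffI)
        fix x assume "x \<in> v ` {p..<n}"
        then obtain i where "p \<le> i" "i < n" "x = v i"
          by auto
        then show "x \<in> (\<lambda>i. bs ! i) ` {..<length bs}"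
          by (intro image_eqI[of _ _ "i - p"]) (auto simp: v_def p_def n_def nth_append)
      next
        fix x assume "x \<in> (\<lambda>i. bs ! i) ` {..<length bs}"
        then obtain i where "i < length bs" "x = bs ! i"
          by auto
        then show "x \<in> v ` {p..<n}"
          by (intro image_eqI[of _ _ "p + i"]) (auto simp: v_def p_def n_def nth_append)
      qed
      then show ?thesis
        using bs by (auto simp: set_conv_nth)
    qed
    \<comment> \<open>If no vertex of \<open>G\<close> extends the tuple, then none extends its copy in \<open>H\<close>.\<close>
    have "sat G v (extension_formula p n)"
    proof (rule ccontr)
      assume "\<not> sat G v (extension_formula p n)"
      then have "sat G v (FNeg (extension_formula p n))"
        by simp
      moreover have "fv (FNeg (extension_formula p n)) \<subseteq> {..<n}" "v ` {..<n} \<subseteq> univ G"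
        using fv_extension_formula[OF pn] vn AB(3,4) by auto
      ultimately obtain w where w: "w ` {..<n} \<subseteq> univ H" "qf_equiv {..<n} G v H w"
        and "sat H w (FNeg (extension_formula p n))"
        using transfer_tuple[OF GH] by blast
      then have not_ext: "\<not> sat H w (extension_formula p n)"
        by simp
      have "clique_free r H (w ` {..<p})"
        using clique_free_qf_equiv[OF w(2), of "{..<p}" r] vA freeA pn by auto
      moreover have disj: "w ` {..<p} \<inter> w ` {p..<n} = {}"
      proof (rule ccontr)
        assume "w ` {..<p} \<inter> w ` {p..<n} \<noteq> {}"
        then obtain i j where ij: "i < p" "p \<le> j" "j < n" "w i = w j"
          by auto
        then have "v i = v j"
          using w(2) pn unfolding qf_equiv_def by force
        moreover have "v i \<in> A" "v j \<in> B"
          using vA vB ij by auto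
        ultimately show False
          using AB(5) by auto
      qed
      moreover have "w ` {..<n} = w ` {..<p} \<union> w ` {p..<n}"
        using pn by (simp flip: image_Un add: ivl_disj_un)
      moreover have "w ` {..<p} \<subseteq> univ H" "w ` {p..<n} \<subseteq> univ H"
        using w(1) calculation by blast+
      moreover have "finite (w ` {..<p})" "finite (w ` {p..<n})"
        by simp_all
      ultimately have "sat H w (extension_formula p n)"
        using H unfolding sat_extension_formula[OF pn] henson_def by metis
      then show False
        using not_ext by blast
    qed
    then show ?thesis
      unfolding sat_extension_formula[OF pn] vA vB vn by blast
  qed
  ultimately show ?thesis
    by (auto simp: henson_def)
qed

section \<open>The Fraisse limit\<close>

lemma embedding_complete_graph:
  assumes "is_graph G" "Q \<subseteq> univ G" "finite Q" "card Q = s" "is_clique G Q"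
  obtains f where "embedding f (complete_graph s) G"
proof -
  obtain h where h: "bij_betw h {0..<card Q} Q"
    using ex_bij_betw_nat_finite[OF assms(3)] by blast
  then have inj: "inj_on h {..<s}" and img: "h ` {..<s} = Q"
    using assms(4) by (auto simp: bij_betw_def lessThan_atLeast0)
  have "i \<noteq> j \<longleftrightarrow> edge_rel G (h i) (h j)" if "i < s" "j < s" for i j
  proof -
    have "h i \<in> Q" "h j \<in> Q"
      using that img by auto
    moreover have "h i = h j \<longleftrightarrow> i = j"
      using inj that by (simp add: inj_on_eq_iff)
    ultimately show ?thesis
      using assms(1,2,5) unfolding is_clique_def is_graph_def by (metis subsetD)
  qed
  then have "embedding h (complete_graph s) G"
    using inj img assms(2) by (auto simp: embedding_def complete_graph_def)
  then show ?thesis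
    using that by blast
qed

lemma finite_clique_freeI:
  assumes "finite (univ G)" "is_graph G" "clique_free s G (univ G)"
  shows "finite_clique_free s G"
proof -
  have False if f: "embedding f (complete_graph s) G" for f
  proof -
    have "card (f ` {..<s}) = s" "f ` {..<s} \<subseteq> univ G" "is_clique G (f ` {..<s})"
      using f by (auto simp: embedding_def complete_graph_def card_image is_clique_def)
    then show False
      using assms(3) by (auto simp: clique_free_def)
  qed
  then show ?thesis
    using assms by (auto simp: finite_clique_free_def)
qed

text \<open>The age gives the graph axioms and clique-freeness. For the extension property, the finite graph \<open>A \<union> B\<close>
  with one more vertex, joined exactly to \<open>A\<close>, still has no clique of size \<open>r + 1\<close>, so it embeds in \<open>H\<close>. The
  embedding moves \<open>A \<union> B\<close>, but ultrahomogeneity extends it on \<open>A \<union> B\<close> to an automorphism \<open>g'\<close>, and the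
  preimage of the new vertex under \<open>g'\<close> is as required.\<close>

theorem henson_fraisse_limit:
  assumes "random_clique_free_graph (Suc r) H"
  shows "henson r H"
proof -
  have hom: "ultrahomogeneous H"
    and age: "\<And>A. finite_clique_free (Suc r) A \<longleftrightarrow> finite (univ A) \<and> (\<exists>f. embedding f A H)"
    using assms by (auto simp: random_clique_free_graph_def fraisse_limit_def)
  have graph: "\<not> edge_rel H a a \<and> (edge_rel H a b \<longrightarrow> edge_rel H b a)"
    if "a \<in> univ H" "b \<in> univ H" for a b
  proof -
    obtain h where h: "bij_betw h {0..<card {a, b}} {a, b}"
      using ex_bij_betw_nat_finite[of "{a, b}"] by blast
    define A where "A = \<lparr>univ = {0..<card {a, b}}, edge_rel = (\<lambda>i j. edge_rel H (h i) (h j))\<rparr>"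
    have "embedding h A H"
      using h that by (auto simp: embedding_def A_def bij_betw_def)
    then have "is_graph A"
      using age[of A] by (auto simp: A_def finite_clique_free_def)
    moreover have "a \<in> h ` univ A" "b \<in> h ` univ A"
      using h by (auto simp: A_def bij_betw_def)
    ultimately show ?thesis
      by (auto simp: is_graph_def A_def)
  qed
  then have graphH: "is_graph H"
    by (auto simp: is_graph_def)
  moreover have free: "clique_free (Suc r) H (univ H)"
    unfolding clique_free_def
  proof (intro allI impI notI)
    fix Q assume Q: "Q \<subseteq> univ H" "finite Q" "card Q = Suc r" "is_clique H Q"
    obtain f where "embedding f (complete_graph (Suc r)) H"
      using embedding_complete_graph[OF graphH Q] .
    then have "finite_clique_free (Suc r) (complete_graph (Suc r))"
      using age by (auto simp: complete_graph_def)
    moreover have "embedding id (complete_graph (Suc r)) (complete_graph (Suc r))"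
      by (auto simp: embedding_def)
    ultimately show False
      by (auto simp: finite_clique_free_def)
  qed
  moreover have "\<exists>c\<in>univ H. c \<notin> A \<union> B \<and> (\<forall>a\<in>A. edge_rel H c a) \<and> (\<forall>b\<in>B. \<not> edge_rel H c b)"
    if AB: "finite A" "finite B" "A \<subseteq> univ H" "B \<subseteq> univ H" "A \<inter> B = {}" and freeA: "clique_free r H A" for A B
  proof -
    define n where "n = card (A \<union> B)"
    obtain h where "bij_betw h {0..<n} (A \<union> B)"
      using ex_bij_betw_nat_finite[of "A \<union> B"] AB by (auto simp: n_def)
    then have inj: "inj_on h {..<n}" and img: "h ` {..<n} = A \<union> B"
      by (auto simp: bij_betw_def lessThan_atLeast0)
    have hH: "h i \<in> univ H" if "i < n" for i
      using img that AB by blast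
    define X where "X = \<lparr>univ = {..n}, edge_rel = (\<lambda>i j.
      (i < n \<and> j < n \<and> edge_rel H (h i) (h j)) \<or> (i = n \<and> j < n \<and> h j \<in> A) \<or> (j = n \<and> i < n \<and> h i \<in> A))\<rparr>"
    have "is_graph X"
      unfolding is_graph_def
    proof (intro conjI ballI impI notI)
      fix i assume "i \<in> univ X" "edge_rel X i i"
      then show False
        using graph[OF hH hH, of i i] by (auto simp: X_def)
    next
      fix i j assume "edge_rel X i j"
      then show "edge_rel X j i"
        using graph[OF hH hH, of i j] by (auto simp: X_def)
    qed
    moreover have "clique_free (Suc r) X (univ X)"
      unfolding clique_free_def
    proof (intro allI impI notI)
      fix Q assume Q: "Q \<subseteq> univ X" "finite Q" "card Q = Suc r" "is_clique X Q"
      have sub: "Q - {n} \<subseteq> {..<n}"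
        using Q(1) by (auto simp: X_def)
      have cl: "is_clique H (h ` (Q - {n}))"
        using Q(4) sub by (auto simp: is_clique_def X_def)
      have card: "card (h ` (Q - {n})) = card (Q - {n})"
        by (rule card_image[OF inj_on_subset[OF inj sub]])
      show False
      proof (cases "n \<in> Q")
        case True
        have "h ` (Q - {n}) \<subseteq> A"
          using Q(4) True sub by (auto simp: is_clique_def X_def)
        moreover have "card (h ` (Q - {n})) = r"
          using card True Q(2,3) by simp
        ultimately show False
          using freeA cl Q(2) by (auto simp: clique_free_def)
      next
        case False
        then have "card (h ` (Q - {n})) = Suc r"
          using card Q(3) by simp
        moreover have "h ` (Q - {n}) \<subseteq> univ H"
          using sub hH by auto
        ultimately show False
          using free cl Q(2) unfolding clique_free_def by blast
      qed
    qed
    ultimately have "finite_clique_free (Suc r) X"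
      by (intro finite_clique_freeI) (auto simp: X_def)
    then obtain e where e: "embedding e X H"
      using age by blast
    have univX: "univ X = {..n}"
      by (simp add: X_def)
    have e_edge: "edge_rel X i j \<longleftrightarrow> edge_rel H (e i) (e j)" if "i \<le> n" "j \<le> n" for i j
      using e that unfolding embedding_def univX by blast
    define g where "g a = e (inv_into {..<n} h a)" for a
    have gh: "g (h i) = e i" if "i < n" for i
      using inj that by (simp add: g_def inv_into_f_f)
    have "embedding g (H\<lparr>univ := A \<union> B\<rparr>) H"
    proof -
      have edge: "edge_rel H (h i) (h j) \<longleftrightarrow> edge_rel H (e i) (e j)" if "i < n" "j < n" for i j
        using e_edge[of i j] that by (auto simp: X_def)
      have "e ` {..n} \<subseteq> univ H" and "inj_on e {..n}"
        using e by (auto simp: embedding_def X_def)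
      moreover from this(2) have inj_e: "i = j" if "i < n" "j < n" "e i = e j" for i j
        using that by (auto dest: inj_onD)
      have "inj_on g (h ` {..<n})"
        by (intro inj_onI) (auto simp: gh intro!: arg_cong[where f = h] inj_e)
      ultimately show ?thesis
        using edge unfolding embedding_def by (auto simp flip: img simp: gh)
    qed
    then obtain g' where g': "automorphism g' H" "\<And>a. a \<in> A \<union> B \<Longrightarrow> g' a = g a"
      using hom AB unfolding ultrahomogeneous_def by (metis Un_least finite_Un)
    have en: "e n \<in> univ H"
      using e by (auto simp: embedding_def X_def)
    then obtain c where c: "c \<in> univ H" "g' c = e n"
      using g'(1) unfolding automorphism_def by (metis imageE)
    have g'h: "g' (h i) = e i" if "i < n" for i
    proof -
      have "h i \<in> A \<union> B"
        using img that by blast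
      then show ?thesis
        using g'(2) gh[OF that] by simp
    qed
    have "c \<noteq> h i" if "i < n" for i
    proof
      assume "c = h i"
      then have "e i = e n"
        using g'h[OF that] c by simp
      then show False
        using e that by (auto simp: embedding_def X_def inj_on_def)
    qed
    moreover have "edge_rel H c (h i) \<longleftrightarrow> h i \<in> A" if "i < n" for i
    proof -
      have "edge_rel H c (h i) \<longleftrightarrow> edge_rel H (g' c) (g' (h i))"
        using g'(1) c(1) hH[OF that] by (auto simp: automorphism_def embedding_def)
      also have "\<dots> \<longleftrightarrow> edge_rel H (e n) (e i)"
        using c(2) g'h[OF that] by simp
      also have "\<dots> \<longleftrightarrow> edge_rel X n i"
        using e_edge[of n i] that by simp
      also have "\<dots> \<longleftrightarrow> h i \<in> A"
        using that by (simp add: X_def)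
      finally show ?thesis .
    qed
    moreover have "\<exists>i<n. x = h i" if "x \<in> A \<union> B" for x
      using img that by auto
    ultimately show ?thesis
      using c(1) AB(5) by (intro bexI[of _ c]) (auto, blast+)
  qed
  ultimately show ?thesis
    by (auto simp: henson_def)
qed

section \<open>Types\<close>

section \<open>Types of a single vertex\<close>

definition generic :: "'a struc \<Rightarrow> 'a set \<Rightarrow> 'a list \<Rightarrow> 'a \<Rightarrow> bool" where
  "generic G D bs x \<longleftrightarrow> x \<in> univ G \<and> (\<forall>b\<in>set bs. x \<noteq> b \<and> (edge_rel G x b \<longleftrightarrow> b \<in> D))"

text \<open>The type over \<open>A\<close> of a vertex outside \<open>A\<close> whose neighbours in \<open>A\<close> are those in \<open>D\<close>. With \<open>A\<close> the whole
  universe and \<open>D\<close> empty it is \<open>p\<^sub>*\<close>. The existential quantifier in it could equally be universal, by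
  \<open>holds_generic\<close> and \<open>generic_exists\<close>.\<close>

definition adjacency_type :: "'a struc \<Rightarrow> 'a set \<Rightarrow> 'a set \<Rightarrow> 'a pfm set" where
  "adjacency_type G A D =
     {(\<phi>, b) \<in> pformulas 1 A. \<exists>x. generic G D b x \<and> holds G (\<phi>, b) [x]}"

lemma generic_subset: "generic G D bs x \<Longrightarrow> set cs \<subseteq> set bs \<Longrightarrow> generic G D cs x"
  by (auto simp: generic_def)

lemma generic_exists:
  assumes "henson r G" "clique_free r G D" "set bs \<subseteq> univ G"
  obtains x where "generic G D bs x"
proof -
  have "clique_free r G (set bs \<inter> D)"
    using assms(2) by (rule clique_free_mono) simp
  moreover have "finite (set bs \<inter> D)" "finite (set bs - D)" "set bs \<inter> D \<subseteq> univ G"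
    "set bs - D \<subseteq> univ G" "(set bs \<inter> D) \<inter> (set bs - D) = {}"
    using assms(3) by auto
  ultimately obtain c where "c \<in> univ G" "c \<notin> (set bs \<inter> D) \<union> (set bs - D)"
    "\<forall>a\<in>set bs \<inter> D. edge_rel G c a" "\<forall>b\<in>set bs - D. \<not> edge_rel G c b"
    using assms(1) unfolding henson_def by metis
  then have "generic G D bs c"
    by (auto simp: generic_def)
  then show ?thesis
    using that by blast
qed

text \<open>A generic vertex is new, with prescribed neighbours in \<open>b\<close>, so its quantifier-free type over \<open>b\<close> is determined.\<close>

lemma holds_generic:
  assumes G: "henson r G" and \<phi>: "(\<phi>, b) \<in> pformulas 1 (univ G)"
    and x: "generic G D b x" and y: "generic G D b y"
  shows "holds G (\<phi>, b) [x] \<longleftrightarrow> holds G (\<phi>, b) [y]"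
proof -
  have graph: "is_graph G"
    using G by (simp add: henson_def)
  have fv: "fv \<phi> \<subseteq> {..<Suc (length b)}" and b: "set b \<subseteq> univ G"
    using \<phi> by (auto simp: pformulas_def)
  have cases: "i = 0 \<or> (\<exists>j<length b. i = Suc j)" if "i \<in> fv \<phi>" for i
    using that fv by (cases i) auto
  have mem: "z \<in> univ G" "b ! j \<in> univ G" "z \<noteq> b ! j"
    "edge_rel G z (b ! j) \<longleftrightarrow> b ! j \<in> D" "edge_rel G (b ! j) z \<longleftrightarrow> b ! j \<in> D" "\<not> edge_rel G z z"
    if "generic G D b z" "j < length b" for z j
  proof -
    have "b ! j \<in> set b"
      using that(2) by simp
    then show *: "z \<in> univ G" "b ! j \<in> univ G" "z \<noteq> b ! j" "edge_rel G z (b ! j) \<longleftrightarrow> b ! j \<in> D"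
      using that(1) b by (auto simp: generic_def)
    show "edge_rel G (b ! j) z \<longleftrightarrow> b ! j \<in> D" "\<not> edge_rel G z z"
      using * is_graph_commute[OF graph] graph unfolding is_graph_def by blast+
  qed
  have irr: "\<not> edge_rel G x x" "\<not> edge_rel G y y"
    using x y graph by (auto simp: generic_def is_graph_def)
  have "qf_equiv (fv \<phi>) G (\<lambda>i. ([x] @ b) ! i) G (\<lambda>i. ([y] @ b) ! i)"
    unfolding qf_equiv_def
  proof (intro ballI)
    fix i j assume "i \<in> fv \<phi>" "j \<in> fv \<phi>"
    from cases[OF this(1)] cases[OF this(2)]
    show "(([x] @ b) ! i = ([x] @ b) ! j \<longleftrightarrow> ([y] @ b) ! i = ([y] @ b) ! j) \<and>
      (edge_rel G (([x] @ b) ! i) (([x] @ b) ! j) \<longleftrightarrow> edge_rel G (([y] @ b) ! i) (([y] @ b) ! j))"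
      by (elim disjE exE conjE)
        (simp_all add: irr mem(4-6)[OF x] mem(4-6)[OF y] mem(3)[OF x] mem(3)[OF y]
          mem(3)[OF x, symmetric] mem(3)[OF y, symmetric])
  qed
  moreover have "(\<lambda>i. ([z] @ b) ! i) ` fv \<phi> \<subseteq> univ G" if "generic G D b z" for z
  proof
    fix u assume "u \<in> (\<lambda>i. ([z] @ b) ! i) ` fv \<phi>"
    then obtain i where "i \<in> fv \<phi>" "u = ([z] @ b) ! i"
      by blast
    with cases[of i] mem(2)[OF that] that show "u \<in> univ G"
      by (auto simp: generic_def)
  qed
  ultimately show ?thesis
    using sat_qf_equiv[OF G G] x y by simp
qed

text \<open>Finitely many formulas of the type are satisfied together by one vertex that is generic over
  all their parameters.\<close>

lemma adjacency_type_in_types: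
  assumes G: "henson r G" and A: "A \<subseteq> univ G" and D: "clique_free r G D"
  shows "adjacency_type G A D \<in> types G 1 A"
  unfolding types_def
proof (intro CollectI conjI ballI)
  show "adjacency_type G A D \<subseteq> pformulas 1 A"
    by (auto simp: adjacency_type_def)
  show "finitely_satisfiable G 1 (adjacency_type G A D)"
    unfolding finitely_satisfiable_def
  proof (intro allI impI)
    fix F assume F: "finite F" "F \<subseteq> adjacency_type G A D"
    obtain bs where bs: "set bs = (\<Union>\<phi>\<in>F. set (snd \<phi>))"
      using finite_list[of "\<Union>\<phi>\<in>F. set (snd \<phi>)"] F(1) by auto
    have "set bs \<subseteq> univ G"
      using bs F(2) A by (force simp: adjacency_type_def pformulas_def)
    then obtain x where x: "generic G D bs x"
      using generic_exists[OF G D] by blast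
    have "holds G \<phi> [x]" if mem_F: "\<phi> \<in> F" for \<phi>
    proof -
      obtain \<psi> b where \<phi>: "\<phi> = (\<psi>, b)"
        by (cases \<phi>)
      then obtain y where y: "generic G D b y" "holds G (\<psi>, b) [y]" and mem: "(\<psi>, b) \<in> pformulas 1 A"
        using mem_F F(2) by (auto simp: adjacency_type_def)
      have "set b \<subseteq> set bs"
        using mem_F by (force simp: bs \<phi>)
      then have "generic G D b x"
        by (rule generic_subset[OF x])
      moreover have "(\<psi>, b) \<in> pformulas 1 (univ G)"
        using mem A by (auto simp: pformulas_def)
      ultimately show ?thesis
        unfolding \<phi> using holds_generic[OF G _ y(1)] y(2) by blast
    qed
    then show "\<exists>a\<in>tuples 1 (univ G). \<forall>\<phi>\<in>F. holds G \<phi> a"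
      using x by (intro bexI[of _ "[x]"]) (auto simp: tuples_def generic_def)
  qed
  fix \<phi> assume "\<phi> \<in> pformulas 1 A"
  moreover obtain \<psi> b where \<phi>: "\<phi> = (\<psi>, b)"
    by (cases \<phi>)
  ultimately have mem: "(\<psi>, b) \<in> pformulas 1 A" "(FNeg \<psi>, b) \<in> pformulas 1 A" "set b \<subseteq> univ G"
    using A by (auto simp: pformulas_def)
  obtain x where "generic G D b x"
    using generic_exists[OF G D mem(3)] .
  then show "\<phi> \<in> adjacency_type G A D \<or> pneg \<phi> \<in> adjacency_type G A D"
    using mem by (auto simp: \<phi> adjacency_type_def)
qed

lemma type_satisfiable:
  assumes "p \<in> types G n A" "finite F" "F \<subseteq> p"
  obtains a where "a \<in> tuples n (univ G)" "\<And>\<phi>. \<phi> \<in> F \<Longrightarrow> holds G \<phi> a"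
proof -
  have "\<exists>a\<in>tuples n (univ G). \<forall>\<phi>\<in>F. holds G \<phi> a"
    using assms by (simp add: types_def finitely_satisfiable_def)
  then show ?thesis
    using that by blast
qed

lemma type_negation:
  assumes "p \<in> types G n A" "\<phi> \<in> pformulas n A" "\<phi> \<notin> p"
  shows "pneg \<phi> \<in> p"
  using assms unfolding types_def by blast

lemma holds_pneg: "holds G (pneg \<phi>) a \<longleftrightarrow> \<not> holds G \<phi> a"
  by (cases \<phi>) simp

lemma nonadjacency_subset: 
  assumes "henson r U" "0 < r"
  shows "nonadjacency U \<subseteq> adjacency_type U (univ U) {}"
proof
  fix \<phi> assume "\<phi> \<in> nonadjacency U"
  then obtain b where b: "b \<in> univ U" "\<phi> = (FNeg (FEdge 0 1), [b])"
    by (auto simp: nonadjacency_def)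
  obtain x where "generic U {} [b] x"
    using generic_exists[OF assms(1) clique_free_empty[OF assms(2)], of "[b]"] b(1) by auto
  then show "\<phi> \<in> adjacency_type U (univ U) {}"
    using b by (auto simp: adjacency_type_def pformulas_def generic_def)
qed

text \<open>Nonadjacency to all vertices implies being different from all of them: every vertex \<open>c\<close> has a neighbour
  \<open>nb c\<close>, and something not adjacent to \<open>nb c\<close> is not \<open>c\<close>. So finitely many formulas in \<open>nonadjacency U\<close> force a
  realization of them to be generic over \<open>b\<close>, which decides \<open>\<phi>(x, b)\<close>.\<close>

lemma global_type_of_nonadjacency:
  assumes U: "henson r U" and r: "1 < r"
  shows "p \<in> global_types U 1 \<and> nonadjacency U \<subseteq> p \<longleftrightarrow> p = adjacency_type U (univ U) {}"
proof
  have free: "clique_free r U {}"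
    using r by (intro clique_free_empty) simp
  assume "p = adjacency_type U (univ U) {}"
  then show "p \<in> global_types U 1 \<and> nonadjacency U \<subseteq> p"
    using adjacency_type_in_types[OF U order_refl free] nonadjacency_subset[OF U] r by auto
next
  assume "p \<in> global_types U 1 \<and> nonadjacency U \<subseteq> p"
  then have p: "p \<in> global_types U 1" and nonadj: "\<And>b. b \<in> univ U \<Longrightarrow> (FNeg (FEdge 0 1), [b]) \<in> p"
    by (auto simp: nonadjacency_def)
  have free: "clique_free r U {}"
    using r by (intro clique_free_empty) simp
  have sub: "\<phi> \<in> adjacency_type U (univ U) {}" if "\<phi> \<in> p" for \<phi>
  proof -
    obtain \<psi> b where \<phi>: "\<phi> = (\<psi>, b)"
      by (cases \<phi>)
    have mem: "(\<psi>, b) \<in> pformulas 1 (univ U)"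
      using that p by (auto simp: types_def \<phi>)
    then have b: "set b \<subseteq> univ U"
      by (auto simp: pformulas_def)
    have "\<exists>d\<in>univ U. edge_rel U c d" if c: "c \<in> univ U" for c
    proof -
      have "clique_free r U {c}"
        using r by (intro clique_free_few) auto
      then obtain d where d: "generic U {c} [c] d"
        using generic_exists[OF U, of "{c}" "[c]"] c by auto
      have "is_graph U"
        using U by (simp add: henson_def)
      from is_graph_commute[OF this c] d show ?thesis
        by (auto simp: generic_def)
    qed
    then obtain nb where nb: "\<And>c. c \<in> univ U \<Longrightarrow> nb c \<in> univ U \<and> edge_rel U c (nb c)"
      by metis
    define F where "F = insert \<phi> ((\<lambda>c. (FNeg (FEdge 0 1), [c])) ` (set b \<union> nb ` set b))"
    have "finite F" "F \<subseteq> p"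
      using that nonadj nb b by (auto simp: F_def)
    then obtain a where a: "a \<in> tuples 1 (univ U)" "\<And>\<phi>. \<phi> \<in> F \<Longrightarrow> holds U \<phi> a"
      using type_satisfiable[OF p] by blast
    from a(1) obtain x where x: "a = [x]" "x \<in> univ U"
      by (auto simp: tuples_def length_Suc_conv)
    have nonadj_x: "\<not> edge_rel U x c" if "c \<in> set b \<union> nb ` set b" for c
      using a(2)[of "(FNeg (FEdge 0 1), [c])"] that by (auto simp: F_def x(1))
    have "generic U {} b x"
      unfolding generic_def
    proof (intro conjI ballI)
      fix c assume c: "c \<in> set b"
      show "x \<noteq> c"
        using nonadj_x[of "nb c"] nb[of c] c b by auto
      show "edge_rel U x c \<longleftrightarrow> c \<in> {}"
        using nonadj_x[of c] c by auto
    qed (rule x(2))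
    moreover have "holds U (\<psi>, b) [x]"
      using a(2)[of \<phi>] by (simp add: F_def x(1) \<phi>)
    ultimately show ?thesis
      using mem by (auto simp: adjacency_type_def \<phi>)
  qed
  moreover have "\<phi> \<in> p" if "\<phi> \<in> adjacency_type U (univ U) {}" for \<phi>
  proof (rule ccontr)
    assume "\<phi> \<notin> p"
    moreover have "\<phi> \<in> pformulas 1 (univ U)"
      using that by (auto simp: adjacency_type_def)
    ultimately have "pneg \<phi> \<in> adjacency_type U (univ U) {}"
      using type_negation[OF p] sub by blast
    then have "finite {\<phi>, pneg \<phi>}" "{\<phi>, pneg \<phi>} \<subseteq> adjacency_type U (univ U) {}"
      using that by auto
    then obtain a where "\<And>\<psi>. \<psi> \<in> {\<phi>, pneg \<phi>} \<Longrightarrow> holds U \<psi> a"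
      using type_satisfiable[OF adjacency_type_in_types[OF U order_refl free]] by blast
    from this[of \<phi>] this[of "pneg \<phi>"] show False
      by (simp add: holds_pneg)
  qed
  ultimately show "p = adjacency_type U (univ U) {}"
    by blast
qed

lemma keisler_measure_delta:
  assumes p: "p \<in> global_types U n"
  shows "keisler_measure U n (delta p)"
proof -
  have sat: "\<exists>a\<in>tuples n (univ U). \<forall>\<phi>\<in>F. holds U \<phi> a" if "finite F" "F \<subseteq> p" for F
    by (rule type_satisfiable[OF p that]) blast
  have neg: "pneg \<phi> \<in> p" if "\<phi> \<in> pformulas n (univ U)" "\<phi> \<notin> p" for \<phi>
    using type_negation[OF p that] .
  have "\<phi> \<in> p" if "\<phi> \<in> pformulas n (univ U)" "solutions U n \<phi> = tuples n (univ U)" for \<phi>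
  proof (rule ccontr)
    assume "\<phi> \<notin> p"
    then have "\<exists>a\<in>tuples n (univ U). \<not> holds U \<phi> a"
      using sat[of "{pneg \<phi>}"] neg[OF that(1)] by (auto simp: holds_pneg)
    then show False
      using that(2) unfolding solutions_def by blast
  qed
  moreover have "delta p \<theta> = delta p \<phi> + delta p \<psi>"
    if mem: "\<phi> \<in> pformulas n (univ U)" "\<psi> \<in> pformulas n (univ U)" "\<theta> \<in> pformulas n (univ U)"
      and disj: "solutions U n \<phi> \<inter> solutions U n \<psi> = {}"
      and union: "solutions U n \<theta> = solutions U n \<phi> \<union> solutions U n \<psi>" for \<phi> \<psi> \<theta>
  proof -
    have union': "holds U \<theta> a \<longleftrightarrow> holds U \<phi> a \<or> holds U \<psi> a"
      and disj': "\<not> (holds U \<phi> a \<and> holds U \<psi> a)" if "a \<in> tuples n (univ U)" for a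
      using that union disj unfolding solutions_def by blast+
    have "\<not> (\<phi> \<in> p \<and> \<psi> \<in> p)"
      using sat[of "{\<phi>, \<psi>}"] disj' by auto
    moreover have "\<theta> \<in> p" if "\<phi> \<in> p \<or> \<psi> \<in> p"
    proof (rule ccontr)
      assume "\<theta> \<notin> p"
      then have "pneg \<theta> \<in> p"
        using neg mem by blast
      then show False
        using that sat[of "{\<phi>, pneg \<theta>}"] sat[of "{\<psi>, pneg \<theta>}"] union' by (auto simp: holds_pneg)
    qed
    moreover have "\<phi> \<in> p \<or> \<psi> \<in> p" if "\<theta> \<in> p"
    proof (rule ccontr)
      assume "\<not> (\<phi> \<in> p \<or> \<psi> \<in> p)"
      then have "{\<theta>, pneg \<phi>, pneg \<psi>} \<subseteq> p"
        using neg mem that by blast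
      then show False
        using sat[of "{\<theta>, pneg \<phi>, pneg \<psi>}"] union' by (auto simp: holds_pneg)
    qed
    ultimately show ?thesis
      by (auto simp: delta_def)
  qed
  ultimately show ?thesis
    by (auto simp: keisler_measure_def delta_def)
qed

section \<open>Averages\<close>

section \<open>Averages over sparse sequences\<close>

text \<open>No single vertex \<open>b\<close> is equal or adjacent to more than a fraction \<open>\<epsilon>\<close> of the sequence.\<close>

definition sparse :: "'a struc \<Rightarrow> real \<Rightarrow> 'a list list \<Rightarrow> bool" where
  "sparse U \<epsilon> as \<longleftrightarrow> (\<forall>b\<in>univ U.
     real (card {i. i < length as \<and> \<not> generic U {} [b] (hd (as ! i))}) \<le> \<epsilon> * real (length as))"

text \<open>Entries that are generic over all of \<open>b\<close> give \<open>\<phi>(x, b)\<close> the truth value it has in the type. The others fail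
  at some parameter in \<open>b\<close>, and each parameter accounts for a fraction \<open>\<epsilon>\<close>.\<close>

lemma average_close_to_delta:
  assumes U: "henson r U" and as: "as \<in> finite_seqs 1 (univ U)" and sparse: "sparse U \<epsilon> as"
    and \<phi>: "(\<phi>, b) \<in> pformulas 1 (univ U)"
  shows "\<bar>delta (adjacency_type U (univ U) {}) (\<phi>, b) - Av U as (\<phi>, b)\<bar> \<le> real (length b) * \<epsilon>"
proof -
  let ?p = "adjacency_type U (univ U) {}" and ?L = "length as"
  let ?x = "\<lambda>i. hd (as ! i)"
  define B where "B = {i. i < ?L \<and> \<not> generic U {} b (?x i)}"
  define S where "S = {i. i < ?L \<and> holds U (\<phi>, b) (as ! i)}"
  have L: "0 < ?L"
    using as by (auto simp: finite_seqs_def)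
  have entry: "as ! i = [?x i]" "?x i \<in> univ U" if "i < ?L" for i
  proof -
    have "as ! i \<in> tuples 1 (univ U)"
      using as that by (auto simp: finite_seqs_def)
    then show "as ! i = [?x i]" "?x i \<in> univ U"
      by (auto simp: tuples_def length_Suc_conv)
  qed
  have b: "set b \<subseteq> univ U"
    using \<phi> by (auto simp: pformulas_def)
  have "B \<subseteq> (\<Union>c\<in>set b. {i. i < ?L \<and> \<not> generic U {} [c] (?x i)})"
    using entry(2) by (auto simp: B_def generic_def)
  then have "card B \<le> card (\<Union>c\<in>set b. {i. i < ?L \<and> \<not> generic U {} [c] (?x i)})"
    by (intro card_mono) auto
  also have "\<dots> \<le> (\<Sum>c\<in>set b. card {i. i < ?L \<and> \<not> generic U {} [c] (?x i)})"
    by (intro card_UN_le) simp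
  finally have "real (card B) \<le> (\<Sum>c\<in>set b. real (card {i. i < ?L \<and> \<not> generic U {} [c] (?x i)}))"
    unfolding of_nat_sum[symmetric] of_nat_le_iff .
  also have "\<dots> \<le> (\<Sum>c\<in>set b. \<epsilon> * real ?L)"
    using sparse b unfolding sparse_def by (intro sum_mono) blast
  also have "\<dots> \<le> real (length b) * (\<epsilon> * real ?L)"
  proof (cases "b = []")
    case False
    then obtain c where "c \<in> set b"
      by (cases b) auto
    then have "0 \<le> \<epsilon> * real ?L"
      using sparse b unfolding sparse_def by (meson of_nat_0_le_iff order_trans subsetD)
    then show ?thesis
      using card_length[of b] by (simp add: mult_right_mono)
  qed auto
  finally have B: "real (card B) \<le> real (length b) * \<epsilon> * real ?L"
    by simp
  have finS: "finite S" and finB: "finite B" and SL: "S \<subseteq> {..<?L}" and BL: "B \<subseteq> {..<?L}"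
    by (auto simp: S_def B_def)
  have gen: "holds U (\<phi>, b) (as ! i) \<longleftrightarrow> (\<phi>, b) \<in> ?p" if "i < ?L" "i \<notin> B" for i
  proof -
    have "generic U {} b (?x i)"
      using that by (auto simp: B_def)
    moreover have "(\<phi>, b) \<in> ?p \<longleftrightarrow> (\<exists>y. generic U {} b y \<and> holds U (\<phi>, b) [y])"
      using \<phi> by (simp add: adjacency_type_def del: holds.simps)
    ultimately have "holds U (\<phi>, b) [?x i] \<longleftrightarrow> (\<phi>, b) \<in> ?p"
      using holds_generic[OF U \<phi>] by blast
    then show ?thesis
      using entry(1)[OF that(1)] by simp
  qed
  have "\<bar>delta ?p (\<phi>, b) - Av U as (\<phi>, b)\<bar> * real ?L \<le> real (card B)"
  proof (cases "(\<phi>, b) \<in> ?p")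
    case True
    have "{..<?L} - S \<subseteq> B"
      using gen True by (auto simp: S_def)
    then have "card ({..<?L} - S) \<le> card B"
      using finB by (rule card_mono[rotated])
    then have "?L - card S \<le> card B"
      using SL finS by (simp add: card_Diff_subset)
    moreover have SL': "card S \<le> ?L"
      using card_mono[OF _ SL] by simp
    ultimately have "real ?L - real (card S) \<le> real (card B)"
      by linarith
    moreover have "delta ?p (\<phi>, b) - Av U as (\<phi>, b) = (real ?L - real (card S)) / real ?L"
      using True L by (simp add: delta_def Av_def S_def diff_divide_distrib)
    ultimately show ?thesis
      using SL' L by simp
  next
    case False
    have "S \<subseteq> B"
      using gen False by (auto simp: S_def)
    then have "card S \<le> card B"
      using finB by (rule card_mono[rotated])
    then show ?thesis
      using False L by (simp add: delta_def Av_def S_def)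
  qed
  then have "\<bar>delta ?p (\<phi>, b) - Av U as (\<phi>, b)\<bar> * real ?L \<le> (real (length b) * \<epsilon>) * real ?L"
    using B by linarith
  then show ?thesis
    using L by simp
qed

text \<open>List the vertices of a copy in \<open>M\<close> of an Erdos-Rogers graph. For a vertex \<open>b\<close> of \<open>U\<close> the entries
  equal to \<open>b\<close> and the entries adjacent to \<open>b\<close> are two sets without cliques of size \<open>r\<close>, hence both small; the
  first uses \<open>r > 1\<close>.\<close>

lemma exists_sparse_sequence:
  assumes U: "henson r U" and M: "M \<subseteq> univ U" "henson r (U\<lparr>univ := M\<rparr>)" and "1 < r" "0 < \<epsilon>"
  obtains as where "as \<in> finite_seqs 1 M" "sparse U \<epsilon> as"
proof -
  obtain q :: nat where q: "2 / \<epsilon> < real q"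
    using reals_Archimedean2 by blast
  then have "0 < q"
    using assms(5) by (metis divide_pos_pos of_nat_0_less_iff order_less_trans zero_less_numeral)
  moreover have "0 < r"
    using assms(4) by simp
  ultimately obtain G :: "nat struc" where G: "finite (univ G)" "univ G \<noteq> {}" "is_graph G"
    "clique_free (Suc r) G (univ G)"
    and small: "\<And>S. S \<subseteq> univ G \<Longrightarrow> clique_free r G S \<Longrightarrow> q * card S \<le> card (univ G)"
    using erdos_rogers[of r q] by metis
  obtain f where f: "f ` univ G \<subseteq> M" "qf_equiv (univ G) G id (U\<lparr>univ := M\<rparr>) f"
    using embed_finite_graph[OF M(2) G(3,4,1)] by auto
  then have eq: "qf_equiv (univ G) U f G id"
    by (auto simp: qf_equiv_def)
  define vs where "vs = sorted_list_of_set (univ G)"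
  have vs: "set vs = univ G" "distinct vs" "length vs = card (univ G)"
    using G(1) by (auto simp: vs_def)
  define as where "as = map (\<lambda>v. [f v]) vs"
  have "as \<in> finite_seqs 1 M"
    using G(2) vs(1) f(1) by (auto simp: as_def finite_seqs_def tuples_def)
  moreover have "sparse U \<epsilon> as"
    unfolding sparse_def
  proof
    fix b assume b: "b \<in> univ U"
    define S1 where "S1 = {v \<in> univ G. f v = b}"
    define S2 where "S2 = {v \<in> univ G. edge_rel U (f v) b}"
    have sub: "S1 \<subseteq> univ G" "S2 \<subseteq> univ G"
      by (auto simp: S1_def S2_def)
    have fU: "f v \<in> univ U" if "v \<in> univ G" for v
      using f(1) M(1) that by blast
    have graph: "is_graph U" and free: "clique_free (Suc r) U (univ U)"
      using U by (auto simp: henson_def)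
    have "clique_free r U (f ` S1)"
    proof -
      have "f ` S1 \<subseteq> {b}"
        by (auto simp: S1_def)
      moreover have "clique_free r U {b}"
        using assms(4) by (intro clique_free_few) auto
      ultimately show ?thesis
        by (rule clique_free_mono[rotated])
    qed
    then have "clique_free r G (id ` S1)"
      by (rule clique_free_qf_equiv[OF eq sub(1)])
    then have 1: "q * card S1 \<le> card (univ G)"
      using small[OF sub(1)] by simp
    have "clique_free r U (f ` S2)"
      by (rule clique_free_neighbours[OF graph free b])
        (use fU is_graph_commute[OF graph b] in \<open>auto simp: S2_def\<close>)
    then have "clique_free r G (id ` S2)"
      by (rule clique_free_qf_equiv[OF eq sub(2)])
    then have 2: "q * card S2 \<le> card (univ G)"
      using small[OF sub(2)] by simp
    let ?I = "{i. i < length as \<and> \<not> generic U {} [b] (hd (as ! i))}"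
    have "(\<lambda>i. vs ! i) ` ?I \<subseteq> S1 \<union> S2"
    proof
      fix v assume "v \<in> (\<lambda>i. vs ! i) ` ?I"
      then obtain i where i: "i < length vs" "v = vs ! i" "\<not> generic U {} [b] (f v)"
        by (auto simp: as_def)
      then have "v \<in> univ G"
        using vs(1) nth_mem by blast
      then show "v \<in> S1 \<union> S2"
        using i(3) fU by (auto simp: generic_def S1_def S2_def)
    qed
    moreover have "inj_on (\<lambda>i. vs ! i) ?I"
      using vs(2) by (auto simp: as_def inj_on_def nth_eq_iff_index_eq)
    moreover have "finite (S1 \<union> S2)"
      using sub G(1) finite_subset by blast
    ultimately have "card ?I \<le> card (S1 \<union> S2)"
      by (intro card_inj_on_le)
    also have "\<dots> \<le> card S1 + card S2"
      by (rule card_Un_le)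
    finally have "q * card ?I \<le> q * card S1 + q * card S2"
      by (metis distrib_left mult_le_mono2)
    then have "q * card ?I \<le> 2 * length as"
      using 1 2 vs(3) by (simp add: as_def)
    then have "real q * real (card ?I) \<le> 2 * real (length as)"
      by (metis of_nat_le_iff of_nat_mult of_nat_numeral)
    then have *: "\<epsilon> * (real q * real (card ?I)) \<le> \<epsilon> * (2 * real (length as))"
      using assms(5) by (intro mult_left_mono) auto
    have "2 * real (card ?I) \<le> (\<epsilon> * real q) * real (card ?I)"
      using q assms(5) by (intro mult_right_mono) (auto simp: field_simps)
    also have "\<dots> \<le> 2 * (\<epsilon> * real (length as))"
      using * by (simp add: algebra_simps)
    finally show "real (card ?I) \<le> \<epsilon> * real (length as)"
      by simp
  qed
  ultimately show ?thesis
    using that by blast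
qed

section \<open>Submodels\<close>

section \<open>Elementary submodels\<close>

lemma elementary_submodel_models:
  assumes "elementary_submodel M U" "models U T" "\<And>\<sigma>. \<sigma> \<in> T \<Longrightarrow> fv \<sigma> = {}"
  shows "models (U\<lparr>univ := M\<rparr>) T"
proof -
  have "holds (U\<lparr>univ := M\<rparr>) (\<sigma>, []) [] \<longleftrightarrow> holds U (\<sigma>, []) []" if "\<sigma> \<in> T" for \<sigma>
  proof -
    have "(\<sigma>, []) \<in> pformulas 0 {}" "[] \<in> tuples 0 M"
      using assms(3)[OF that] by (auto simp: pformulas_def tuples_def)
    then show ?thesis
      using assms(1) unfolding elementary_submodel_def by blast
  qed
  then show ?thesis
    using assms(1,2) by (auto simp: models_def elementary_submodel_def)
qed

text \<open>The extension property in \<open>M\<close> itself is enough for elementarity, by quantifier elimination.\<close>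

lemma henson_submodel:
  fixes U :: "'a struc"
  assumes U: "henson r U" and M: "henson r (U\<lparr>univ := M\<rparr>)" "M \<subseteq> univ U" "M \<noteq> {}"
  shows "elementary_submodel M U"
  unfolding elementary_submodel_def
proof (intro conjI allI ballI)
  fix n and \<phi> :: "'a pfm" and a assume \<phi>: "\<phi> \<in> pformulas n {}" and a: "a \<in> tuples n M"
  obtain \<psi> where \<psi>: "\<phi> = (\<psi>, [])" "fv \<psi> \<subseteq> {..<n}"
    using \<phi> by (auto simp: pformulas_def)
  have "a ! i \<in> M" if "i \<in> fv \<psi>" for i
  proof -
    have "i < length a"
      using that \<psi>(2) a by (auto simp: tuples_def)
    then show ?thesis
      using a nth_mem[of i a] by (auto simp: tuples_def)
  qed
  then have "sat (U\<lparr>univ := M\<rparr>) (\<lambda>i. a ! i) \<psi> \<longleftrightarrow> sat U (\<lambda>i. a ! i) \<psi>"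
    using M(2) by (intro sat_qf_equiv[OF M(1) U]) (auto simp: qf_equiv_def)
  then show "holds (U\<lparr>univ := M\<rparr>) \<phi> a \<longleftrightarrow> holds U \<phi> a"
    by (simp add: \<psi>(1))
qed (use M in auto)

text \<open>Closing the empty set under a function that chooses witnesses for the extension axioms gives the
  values of these terms. They are countably many because the datatype is countable.\<close>

datatype witness_term = Witness "witness_term list" "witness_term list"

instance witness_term :: countable
  by countable_datatype

fun eval_witness :: "('a list \<Rightarrow> 'a list \<Rightarrow> 'a) \<Rightarrow> witness_term \<Rightarrow> 'a" where
  "eval_witness w (Witness ss ts) = w (map (eval_witness w) ss) (map (eval_witness w) ts)"

lemma exists_countable_submodel:
  assumes U: "henson r U" and "0 < r"
  obtains M where "countable M" "elementary_submodel M U" "henson r (U\<lparr>univ := M\<rparr>)"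
proof -
  define good where "good as bs c \<longleftrightarrow> c \<notin> set as \<union> set bs \<and>
    (\<forall>a\<in>set as. edge_rel U c a) \<and> (\<forall>b\<in>set bs. \<not> edge_rel U c b)" for as bs c
  \<comment> \<open>When no good vertex exists, any vertex serves as a default value that stays in the universe.\<close>
  define w where "w as bs = (SOME c. c \<in> univ U \<and> ((\<exists>c\<in>univ U. good as bs c) \<longrightarrow> good as bs c))" for as bs
  have "univ U \<noteq> {}"
    using generic_exists[OF U clique_free_empty[OF assms(2)], of "[]"] by (auto simp: generic_def)
  then have "\<exists>c. c \<in> univ U \<and> ((\<exists>c\<in>univ U. good as bs c) \<longrightarrow> good as bs c)" for as bs
    by blast
  then have w: "w as bs \<in> univ U \<and> ((\<exists>c\<in>univ U. good as bs c) \<longrightarrow> good as bs (w as bs))" for as bs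
    unfolding w_def by (rule someI_ex)
  define M where "M = range (eval_witness w)"
  have MU: "M \<subseteq> univ U"
  proof -
    have "eval_witness w t \<in> univ U" for t
      using w by (cases t) auto
    then show ?thesis
      by (auto simp: M_def)
  qed
  have closed: "w as bs \<in> M" if "set as \<subseteq> M" "set bs \<subseteq> M" for as bs
  proof -
    have "as \<in> lists (range (eval_witness w))" "bs \<in> lists (range (eval_witness w))"
      using that by (auto simp: M_def)
    then obtain ss ts where "as = map (eval_witness w) ss" "bs = map (eval_witness w) ts"
      unfolding lists_image by auto
    then have "w as bs = eval_witness w (Witness ss ts)"
      by simp
    then show ?thesis
      unfolding M_def by blast
  qed
  have "is_graph U" and "clique_free (Suc r) U M"
    using U MU clique_free_mono by (auto simp: henson_def)
  then have "is_graph (U\<lparr>univ := M\<rparr>)" "clique_free (Suc r) (U\<lparr>univ := M\<rparr>) M"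
    using MU by (simp_all add: is_graph_def clique_free_def is_clique_def subset_iff)
  moreover have "\<exists>c\<in>M. c \<notin> A \<union> B \<and> (\<forall>a\<in>A. edge_rel U c a) \<and> (\<forall>b\<in>B. \<not> edge_rel U c b)"
    if AB: "finite A" "finite B" "A \<subseteq> M" "B \<subseteq> M" "A \<inter> B = {}" and free: "clique_free r U A" for A B
  proof -
    obtain as where as: "set as = A"
      using finite_list[OF AB(1)] by blast
    obtain bs where bs: "set bs = B"
      using finite_list[OF AB(2)] by blast
    have "A \<subseteq> univ U" "B \<subseteq> univ U"
      using AB MU by auto
    then have "\<exists>c\<in>univ U. good as bs c"
      using U AB free unfolding henson_def good_def as bs by blast
    then have "good as bs (w as bs)"
      using w by blast
    moreover have "w as bs \<in> M"
      using closed as bs AB by blast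
    ultimately show ?thesis
      unfolding good_def as bs by blast
  qed
  ultimately have M: "henson r (U\<lparr>univ := M\<rparr>)"
    by (simp add: henson_def clique_free_def is_clique_def)
  moreover have "M \<noteq> {}" "countable M"
    by (auto simp: M_def)
  ultimately show ?thesis
    using that henson_submodel[OF U M MU] by blast
qed

section \<open>Sequences of vertices\<close>

section \<open>Limits of types of points\<close>

lemma countable_small:
  assumes "(natLeq, \<kappa>) \<in> ordLess" "countable A"
  shows "small \<kappa> A"
  using assms ordLeq_ordLess_trans countable_card_le_natLeq unfolding small_def by blast

text \<open>Ramsey's theorem for the colouring of pairs by adjacency; the homogeneous set cannot be complete.\<close>

lemma infinite_independent_subset:
  fixes G :: "'a struc"
  assumes "is_graph G" "clique_free r G (univ G)" "infinite Z" "Z \<subseteq> univ G"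
  obtains Y where "Y \<subseteq> Z" "infinite Y" "\<And>x y. x \<in> Y \<Longrightarrow> y \<in> Y \<Longrightarrow> \<not> edge_rel G x y"
proof -
  define f :: "'a set \<Rightarrow> nat" where "f X = (if is_clique G X then 1 else 0)" for X
  have "\<forall>x\<in>Z. \<forall>y\<in>Z. x \<noteq> y \<longrightarrow> f {x, y} < 2"
    by (simp add: f_def)
  from Ramsey2[OF assms(3) this] obtain Y t where Y: "Y \<subseteq> Z" "infinite Y" "t < 2"
    "\<forall>x\<in>Y. \<forall>y\<in>Y. x \<noteq> y \<longrightarrow> f {x, y} = t"
    by blast
  have "t = 0"
  proof (rule ccontr)
    assume "t \<noteq> 0"
    then have "is_clique G {x, y}" if "x \<in> Y" "y \<in> Y" "x \<noteq> y" for x y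
      using Y(3,4) that by (force simp: f_def split: if_splits)
    then have "is_clique G Y"
      by (auto simp: is_clique_def)
    moreover obtain Q where Q: "finite Q" "card Q = r" "Q \<subseteq> Y"
      using infinite_arbitrarily_large[OF Y(2)] by blast
    ultimately have "is_clique G Q"
      by (auto simp: is_clique_def)
    moreover have "Q \<subseteq> univ G"
      using Q(3) Y(1) assms(4) by blast
    ultimately show False
      using assms(2) Q(1,2) unfolding clique_free_def by blast
  qed
  have "\<not> edge_rel G x y" if xy: "x \<in> Y" "y \<in> Y" for x y
  proof
    assume edge: "edge_rel G x y"
    have U: "x \<in> univ G" "y \<in> univ G"
      using xy Y(1) assms(4) by auto
    have "x \<noteq> y"
      using edge U assms(1) by (auto simp: is_graph_def)
    moreover have "is_clique G {x, y}"
      using edge is_graph_commute[OF assms(1) U] by (auto simp: is_clique_def)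
    ultimately have "f {x, y} = 0" "f {x, y} = 1"
      using Y(4) xy \<open>t = 0\<close> by (blast, simp add: f_def)
    then show False
      by simp
  qed
  then show ?thesis
    using that Y by blast
qed

lemma infinite_split:
  fixes Y :: "'a set"
  assumes "infinite Y"
  obtains D where "D \<subseteq> Y" "infinite D" "infinite (Y - D)"
proof -
  obtain C :: "nat \<Rightarrow> 'a set" where C: "pairwise (\<lambda>i j. disjnt (C i) (C j)) UNIV"
    "(\<Union>i. C i) \<subseteq> Y" "\<And>i. infinite (C i)"
    using infinite_infinite_partition[OF assms] by blast
  have "C 1 \<subseteq> Y - C 0"
    using C(1,2) by (fastforce simp: pairwise_def disjnt_def)
  then show ?thesis
    using that[of "C 0"] C(2,3) by (metis UN_subset_iff UNIV_I finite_subset)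
qed

text \<open>The sequence avoids each vertex eventually, so its range is infinite and contains an infinite independent
  set \<open>Y\<close>. An independent set has no clique of size \<open>r > 1\<close>, so every subset \<open>D\<close> of \<open>Y\<close> is the neighbourhood in \<open>Y\<close>
  prescribed by some complete type over \<open>Y\<close>. This type is realized because \<open>Y\<close> is countable and the degree of
  saturation is not. Take \<open>D\<close> infinite with infinite complement in \<open>Y\<close>.\<close>

lemma exists_vertex_splitting_sequence:
  assumes U: "henson r U" and "1 < r" and sat: "saturated \<kappa> U" "(natLeq, \<kappa>) \<in> ordLess"
    and c: "\<And>i. c i \<in> univ U" "\<And>b. b \<in> univ U \<Longrightarrow> \<forall>\<^sub>F i in sequentially. c i \<noteq> b"
  obtains b where "b \<in> univ U" "\<exists>\<^sub>F i in sequentially. edge_rel U (c i) b"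
    "\<exists>\<^sub>F i in sequentially. \<not> edge_rel U (c i) b"
proof -
  have graph: "is_graph U" and free: "clique_free (Suc r) U (univ U)"
    using U by (auto simp: henson_def)
  have "infinite (range c)"
  proof
    assume "finite (range c)"
    then have "\<forall>\<^sub>F i in sequentially. \<forall>b\<in>range c. c i \<noteq> b"
      using c by (intro eventually_ball_finite) auto
    then show False
      by (auto simp: eventually_sequentially)
  qed
  then obtain Y where Y: "Y \<subseteq> range c" "infinite Y" "\<And>x y. x \<in> Y \<Longrightarrow> y \<in> Y \<Longrightarrow> \<not> edge_rel U x y"
    using infinite_independent_subset[OF graph free] c(1) by (metis image_subsetI)
  obtain D where D: "D \<subseteq> Y" "infinite D" "infinite (Y - D)"
    using infinite_split[OF Y(2)] .
  have YU: "Y \<subseteq> univ U"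
    using Y(1) c(1) by blast
  have freeD: "clique_free r U D"
    using assms(2) D(1) Y(3) by (intro clique_free_independent) auto
  have "small \<kappa> Y"
    by (rule countable_small[OF sat(2)]) (rule countable_subset[OF Y(1)], simp)
  then obtain x where "x \<in> tuples 1 (univ U)" "\<forall>\<phi>\<in>adjacency_type U Y D. holds U \<phi> x"
    using sat(1) YU adjacency_type_in_types[OF U YU freeD] unfolding saturated_def realized_def by blast
  moreover from this(1) obtain b where "b \<in> univ U" "x = [b]"
    by (auto simp: tuples_def length_Suc_conv)
  ultimately have b: "b \<in> univ U" "\<And>\<phi>. \<phi> \<in> adjacency_type U Y D \<Longrightarrow> holds U \<phi> [b]"
    by blast+
  have edge: "edge_rel U b y \<longleftrightarrow> y \<in> D" if y: "y \<in> Y" for y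
  proof -
    obtain x where x: "generic U D [y] x"
      using generic_exists[OF U freeD, of "[y]"] y YU by auto
    show ?thesis
    proof (cases "y \<in> D")
      case True
      then have "(FEdge 0 1, [y]) \<in> adjacency_type U Y D"
        using x y by (auto simp: adjacency_type_def pformulas_def generic_def)
      from b(2)[OF this] True show ?thesis
        by simp
    next
      case False
      then have "(FNeg (FEdge 0 1), [y]) \<in> adjacency_type U Y D"
        using x y by (auto simp: adjacency_type_def pformulas_def generic_def)
      from b(2)[OF this] False show ?thesis
        by simp
    qed
  qed
  have inf: "\<exists>\<^sub>F i in sequentially. c i \<in> W" if "infinite W" "W \<subseteq> Y" for W
  proof -
    have "W \<subseteq> c ` {i. c i \<in> W}"
      using that(2) Y(1) by auto
    then have "infinite {i. c i \<in> W}"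
      using that(1) finite_surj by blast
    then show ?thesis
      by (simp add: frequently_cofinite flip: cofinite_eq_sequentially)
  qed
  have "\<exists>\<^sub>F i in sequentially. edge_rel U (c i) b"
    by (rule frequently_elim1[OF inf[OF D(2,1)]])
      (use edge D(1) is_graph_commute[OF graph c(1) b(1)] in auto)
  moreover have "\<exists>\<^sub>F i in sequentially. \<not> edge_rel U (c i) b"
    by (rule frequently_elim1[OF inf[OF D(3)]])
      (use edge is_graph_commute[OF graph c(1) b(1)] in auto)
  ultimately show ?thesis
    using that b(1) by blast
qed

lemma eventually_holds:
  assumes lim: "limitin (stone_topology U n) (\<lambda>i. global_tp U (a i)) p sequentially"
    and p: "p \<in> global_types U n" "\<phi> \<in> p"
  shows "\<forall>\<^sub>F i in sequentially. holds U \<phi> (a i)"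
proof -
  let ?O = "{q \<in> global_types U n. \<phi> \<in> q}"
  have "\<phi> \<in> pformulas n (univ U)"
    using p by (auto simp: types_def)
  then have "openin (stone_topology U n) ?O"
    unfolding stone_topology_def by (intro topology_generated_by_Basis) blast
  then have "\<forall>\<^sub>F i in sequentially. global_tp U (a i) \<in> ?O"
    using lim p unfolding limitin_def by blast
  then show ?thesis
    by (rule eventually_mono) (auto simp: global_tp_def)
qed

text \<open>A type that contains \<open>x\<^sub>t = b\<^sub>t\<close> for every coordinate \<open>t\<close> is realized by the tuple of the \<open>b\<^sub>t\<close>.\<close>

lemma unrealized_coordinate:
  assumes p: "p \<in> global_types U n" and "\<not> realized U n p"
  shows "\<exists>t<n. \<forall>b\<in>univ U. (FNeg (FEq t n), [b]) \<in> p"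
proof (rule ccontr)
  assume "\<not> ?thesis"
  then have "\<exists>b\<in>univ U. (FNeg (FEq t n), [b]) \<notin> p" if "t < n" for t
    using that by blast
  moreover have "(FEq t n, [b]) \<in> p" if "t < n" "b \<in> univ U" "(FNeg (FEq t n), [b]) \<notin> p" for t b
    using type_negation[OF p, of "(FEq t n, [b])"] that by (auto simp: pformulas_def)
  ultimately have "\<exists>b\<in>univ U. (FEq t n, [b]) \<in> p" if "t < n" for t
    using that by blast
  then obtain b where b: "\<And>t. t < n \<Longrightarrow> b t \<in> univ U \<and> (FEq t n, [b t]) \<in> p"
    by metis
  define bs where "bs = map b [0..<n]"
  have "holds U \<phi> bs" if \<phi>: "\<phi> \<in> p" for \<phi>
  proof -
    define F where "F = insert \<phi> ((\<lambda>t. (FEq t n, [b t])) ` {..<n})"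
    have "finite F" "F \<subseteq> p"
      using \<phi> b by (auto simp: F_def)
    then obtain a where a: "a \<in> tuples n (univ U)" "\<And>\<phi>. \<phi> \<in> F \<Longrightarrow> holds U \<phi> a"
      using type_satisfiable[OF p] by blast
    have "a ! t = b t" if "t < n" for t
      using a(2)[of "(FEq t n, [b t])"] a(1) that by (auto simp: F_def tuples_def nth_append)
    then have "a = bs"
      using a(1) by (auto simp: tuples_def bs_def intro: nth_equalityI)
    then show ?thesis
      using a(2)[of \<phi>] by (simp add: F_def)
  qed
  moreover have "bs \<in> tuples n (univ U)"
    using b by (auto simp: tuples_def bs_def)
  ultimately show False
    using assms(2) by (auto simp: realized_def)
qed

text \<open>A convergent sequence of types decides each formula \<open>E(x\<^sub>t, b)\<close> eventually, contrary to
  \<open>exists_vertex_splitting_sequence\<close> for an unrealized coordinate \<open>t\<close>.\<close>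

theorem no_seq_approx_type:
  assumes U: "henson r U" and "1 < r" and sat: "saturated \<kappa> U" "(natLeq, \<kappa>) \<in> ordLess"
    and p: "p \<in> global_types U n" "\<not> realized U n p"
  shows "\<not> seq_approx_type \<kappa> U n p"
proof
  assume "seq_approx_type \<kappa> U n p"
  then obtain M a where M: "elementary_submodel M U" and a: "\<And>i. a i \<in> tuples n M"
    and lim: "limitin (stone_topology U n) (\<lambda>i. global_tp U (a i)) p sequentially"
    by (auto simp: seq_approx_type_def small_submodel_def)
  note ev = eventually_holds[OF lim p(1)]
  obtain t where t: "t < n" "\<And>b. b \<in> univ U \<Longrightarrow> (FNeg (FEq t n), [b]) \<in> p"
    using unrealized_coordinate[OF p] by blast
  have len: "length (a i) = n" for i
    using a[of i] by (simp add: tuples_def)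
  have mem: "a i ! t \<in> univ U" for i
  proof -
    have "a i ! t \<in> set (a i)"
      using t(1) by (simp add: len)
    then show ?thesis
      using a[of i] M by (auto simp: tuples_def elementary_submodel_def)
  qed
  have avoid: "\<forall>\<^sub>F i in sequentially. a i ! t \<noteq> b" if "b \<in> univ U" for b
    using ev[OF t(2)[OF that]] by (rule eventually_mono) (use t(1) in \<open>auto simp: nth_append len\<close>)
  obtain b where b: "b \<in> univ U" "\<exists>\<^sub>F i in sequentially. edge_rel U (a i ! t) b"
    "\<exists>\<^sub>F i in sequentially. \<not> edge_rel U (a i ! t) b"
    using exists_vertex_splitting_sequence[where c = "\<lambda>i. a i ! t", OF U assms(2) sat mem avoid] .
  have "(FEdge t n, [b]) \<in> pformulas n (univ U)"
    using t(1) b(1) by (auto simp: pformulas_def)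
  then consider "(FEdge t n, [b]) \<in> p" | "(FNeg (FEdge t n), [b]) \<in> p"
    using type_negation[OF p(1)] by force
  then show False
  proof cases
    case 1
    from ev[OF this] have "\<forall>\<^sub>F i in sequentially. edge_rel U (a i ! t) b"
      by (rule eventually_mono) (use t(1) in \<open>auto simp: nth_append len\<close>)
    then show False
      using b(3) by (simp add: frequently_def)
  next
    case 2
    from ev[OF this] have "\<forall>\<^sub>F i in sequentially. \<not> edge_rel U (a i ! t) b"
      by (rule eventually_mono) (use t(1) in \<open>auto simp: nth_append len\<close>)
    then show False
      using b(2) by (simp add: frequently_def)
  qed
qed

section \<open>The type of an isolated vertex\<close>

theorem proposition4p14:
  fixes s :: nat and H :: "'h struc" and \<kappa> :: "'k rel" and U :: "'a struc"
  assumes "s \<ge> 3"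
    and "random_clique_free_graph s H"
    and "monster_model \<kappa> (theory_of H) U"
  shows "(\<exists>!p. p \<in> global_types U 1 \<and> nonadjacency U \<subseteq> p) \<and>
    seq_approx_measure \<kappa> U 1 (delta (p_star U)) \<and>
    (\<forall>M. small_submodel \<kappa> U M \<longrightarrow> fin_approx_measure U M 1 (delta (p_star U))) \<and>
    \<not> seq_approx_type \<kappa> U 1 (p_star U) \<and>
    (\<forall>n. \<forall>p\<in>global_types U n. \<not> realized U n p \<longrightarrow> \<not> seq_approx_type \<kappa> U n p)"
proof -
  define r where "r = s - 1"
  have r: "1 < r" "0 < r" and s: "s = Suc r"
    using assms(1) by (auto simp: r_def)
  have \<kappa>: "(natLeq, \<kappa>) \<in> ordLess" and sat: "saturated \<kappa> U" and mod: "models U (theory_of H)"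
    using assms(3) by (auto simp: monster_model_def)
  have H: "henson r H"
    using assms(2) henson_fraisse_limit by (simp add: s)
  have U: "henson r U"
    using henson_elementary[OF H mod] .
  define p where "p = adjacency_type U (univ U) {}"
  have char: "q \<in> global_types U 1 \<and> nonadjacency U \<subseteq> q \<longleftrightarrow> q = p" for q
    using global_type_of_nonadjacency[OF U r(1)] by (simp add: p_def)
  have uniq: "\<exists>!p. p \<in> global_types U 1 \<and> nonadjacency U \<subseteq> p"
    unfolding char by simp
  have p_star: "p_star U = p"
    unfolding p_star_def char by simp
  have p: "p \<in> global_types U 1"
    using char[of p] by simp
  have measure: "keisler_measure U 1 (delta p)"
    by (rule keisler_measure_delta[OF p])
  have close: "\<bar>delta p (\<phi>, b) - Av U as (\<phi>, b)\<bar> \<le> real (length b) * \<epsilon>"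
    if "M \<subseteq> univ U" "as \<in> finite_seqs 1 M" "sparse U \<epsilon> as" "(\<phi>, b) \<in> pformulas 1 (univ U)" for M as \<epsilon> \<phi> b
  proof -
    have "as \<in> finite_seqs 1 (univ U)"
      using that(1,2) by (auto simp: finite_seqs_def tuples_def)
    then show ?thesis
      unfolding p_def using average_close_to_delta[OF U _ that(3,4)] by blast
  qed
  have unrealized: "\<not> realized U 1 p"
  proof
    assume "realized U 1 p"
    then obtain a where a: "a \<in> tuples 1 (univ U)" "\<forall>\<phi>\<in>p. holds U \<phi> a"
      unfolding realized_def by blast
    from a(1) obtain x where "x \<in> univ U" "a = [x]"
      by (auto simp: tuples_def length_Suc_conv)
    with a(2) have x: "x \<in> univ U" "\<And>\<phi>. \<phi> \<in> p \<Longrightarrow> holds U \<phi> [x]"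
      by blast+
    obtain y where y: "generic U {} [x] y"
      using generic_exists[OF U clique_free_empty[OF r(2)], of "[x]"] x(1) by auto
    then have "(FNeg (FEq 0 1), [x]) \<in> p"
      using x(1) by (auto simp: p_def adjacency_type_def pformulas_def generic_def)
    from x(2)[OF this] show False
      by simp
  qed
  have none: "\<not> seq_approx_type \<kappa> U n q" if "q \<in> global_types U n" "\<not> realized U n q" for n q
    using no_seq_approx_type[OF U r(1) sat \<kappa> that] .
  have "seq_approx_measure \<kappa> U 1 (delta p)"
  proof -
    obtain M where M: "countable M" "elementary_submodel M U" "henson r (U\<lparr>univ := M\<rparr>)"
      using exists_countable_submodel[OF U r(2)] .
    have MU: "M \<subseteq> univ U"
      using M(2) by (simp add: elementary_submodel_def)
    have "\<exists>as. as \<in> finite_seqs 1 M \<and> sparse U (1 / real (Suc i)) as" for i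
      using exists_sparse_sequence[OF U MU M(3) r(1), of "1 / real (Suc i)"] by force
    then obtain as where as: "\<And>i. as i \<in> finite_seqs 1 M" "\<And>i. sparse U (1 / real (Suc i)) (as i)"
      by metis
    have "(\<lambda>i. Av U (as i) \<phi>) \<longlonglongrightarrow> delta p \<phi>" if "\<phi> \<in> pformulas 1 (univ U)" for \<phi>
    proof -
      obtain \<psi> b where \<phi>: "\<phi> = (\<psi>, b)"
        by (cases \<phi>)
      have bound: "norm (Av U (as i) \<phi> - delta p \<phi>) \<le> real (length b) * (1 / real (Suc i))" for i
        using close[OF MU as(1,2)] that by (simp add: \<phi> abs_minus_commute)
      have lim: "(\<lambda>i. real (length b) * (1 / real (Suc i))) \<longlonglongrightarrow> 0"
        by (rule tendsto_mult_right_zero)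
          (use LIMSEQ_inverse_real_of_nat in \<open>simp add: inverse_eq_divide\<close>)
      have "(\<lambda>i. Av U (as i) \<phi> - delta p \<phi>) \<longlonglongrightarrow> 0"
        by (rule Lim_null_comparison[OF always_eventually[OF allI[OF bound]] lim])
      then show ?thesis
        by (simp add: LIM_zero_iff)
    qed
    moreover have "small_submodel \<kappa> U M"
      using M countable_small[OF \<kappa>] by (simp add: small_submodel_def)
    ultimately show ?thesis
      using measure as(1) unfolding seq_approx_measure_def by blast
  qed
  moreover have "fin_approx_measure U M 1 (delta p)" if "small_submodel \<kappa> U M" for M
    unfolding fin_approx_measure_def
  proof (intro conjI allI impI)
    show "keisler_measure U 1 (delta p)"
      by (rule measure)
    fix m \<phi> and \<epsilon> :: real assume fv: "fv \<phi> \<subseteq> {..<1 + m}" and "0 < \<epsilon>"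
    have M: "elementary_submodel M U"
      using that by (simp add: small_submodel_def)
    then have MU: "M \<subseteq> univ U" and "M \<noteq> {}"
      by (simp_all add: elementary_submodel_def)
    have "models (U\<lparr>univ := M\<rparr>) (theory_of H)"
      using elementary_submodel_models[OF M mod] by (auto simp: theory_of_def)
    then have MH: "henson r (U\<lparr>univ := M\<rparr>)"
      by (rule henson_elementary[OF H])
    \<comment> \<open>A formula with \<open>m\<close> parameters multiplies the fraction by \<open>m\<close>; adding 1 makes the bound strict and covers \<open>m = 0\<close>.\<close>
    define \<delta> where "\<delta> = \<epsilon> / (real m + 1)"
    have \<delta>: "0 < \<delta>" "real m * \<delta> < \<epsilon>"
      using \<open>0 < \<epsilon>\<close> by (simp_all add: \<delta>_def field_simps)
    obtain as where as: "as \<in> finite_seqs 1 M" "sparse U \<delta> as"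
      using exists_sparse_sequence[OF U MU MH r(1) \<delta>(1)] .
    have "(SUP b\<in>tuples m (univ U). \<bar>delta p (\<phi>, b) - Av U as (\<phi>, b)\<bar>) \<le> real m * \<delta>"
    proof (rule cSUP_least)
      obtain x where "x \<in> univ U"
        using MU \<open>M \<noteq> {}\<close> by blast
      then have "replicate m x \<in> tuples m (univ U)"
        by (auto simp: tuples_def)
      then show "tuples m (univ U) \<noteq> {}"
        by blast
      fix b assume b: "b \<in> tuples m (univ U)"
      then have "(\<phi>, b) \<in> pformulas 1 (univ U)"
        using fv by (auto simp: tuples_def pformulas_def)
      from close[OF MU as this] b show "\<bar>delta p (\<phi>, b) - Av U as (\<phi>, b)\<bar> \<le> real m * \<delta>"
        by (simp add: tuples_def)
    qed
    then show "\<exists>as\<in>finite_seqs 1 M. (SUP b\<in>tuples m (univ U). \<bar>delta p (\<phi>, b) - Av U as (\<phi>, b)\<bar>) < \<epsilon>"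
      using as(1) \<delta>(2) by force
  qed
  ultimately show ?thesis
    unfolding p_star using uniq none p unrealized by blast
qed

end
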